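(* Let $P\subset\mathbb{R}^3$ be a full-dimensional polytope, let $Q=P-P$, and let $U$ be uniformly distributed on $S^2$. For each vertex $q$ of $Q$ put $D_q=\|q\|$ (which is positive), let $C_q$ be the spherical normal cell of $Q$ at $q$, and let $\Theta_q(t)$ be the angular aperture of $\operatorname{int}_{S^2}C_q\cap\{u\in S^2:q\cdot u=t\}$ about the axis $q/D_q$. Then the random width $W_P=w_P(U)$ is absolutely continuous and, for almost every $t\in\mathbb{R}$, its density is $$f_{W_P}(t)=\frac{1}{4\pi}\sum_{\substack{q\in\operatorname{vert}Q\\ |t|<D_q}}\frac{\Theta_q(t)}{D_q}.$$ For each vertex $q$, all changes of the analytic branch of $\Theta_q$ occur in the following finite set of candidate values: (1) the axial values $t=\pm\|q\|$; (2) the boundary-tangency values $t=\pm\|q-(q\cdot\hat b)\hat b\|$, where $\{u:b\cdot u=0\}$ supports a boundary arc of $C_q$ and $\hat b=b/\|b\|$; (3) the vertex values $t=q\cdot v$, where $v$ is a spherical vertex of $C_q$. After discarding candidates that do not meet the relevant boundary stratum of $C_q$, the remaining finite set partitions the range into intervals on each of which $\Theta_q$ is given by a fixed real-analytic expression. Consequently every three-dimensional polytope width law reduces to finitely many spherical normal cells, finitely many critical values, and finitely many real-analytic aperture branches.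
   Context: For a compact convex body $K\subset\mathbb{R}^3$, $h_K(u)=\max_{x\in K}u\cdot x$ is the support function and $w_K(u)=h_K(u)+h_K(-u)$ is the width in direction $u\in S^2$. $P-P=\{x-y:x,y\in P\}$. For a vertex $q$ of a polytope $Q$, the normal cone is $N_Q(q)=\{y\in\mathbb{R}^3: y\cdot q\ge y\cdot x\text{ for every }x\in Q\}$ and the spherical normal cell is $C_q=N_Q(q)\cap S^2$; $\operatorname{int}_{S^2}$ is the interior in $S^2$. Angular aperture: with $e_1,e_2$ an orthonormal basis of $q^{\perp}$ and $|t|<D_q$, parametrize the level circle by $u(\theta)=\frac{t}{D_q^2}q+\sqrt{1-t^2/D_q^2}\,(\cos\theta\,e_1+\sin\theta\,e_2)$; then $\Theta_q(t)$ is the Lebesgue measure of the set of $\theta\in[0,2\pi)$ with $u(\theta)\in\operatorname{int}_{S^2}C_q$. A tangency candidate meets its boundary stratum when the corresponding tangency point of the level circle with the great circle $b\cdot u=0$ lies on the boundary arc of $C_q$. *)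

theory Defs
  imports "HOL-Probability.Probability"
begin

text \<open>The normalised surface measure of the unit sphere, as a Borel measure on the whole space:
  the radial projection of the uniform distribution on the unit ball.\<close>

definition uniform_sphere :: "'a::euclidean_space measure" where
  "uniform_sphere = distr (uniform_measure lborel (ball 0 1)) borel (\<lambda>x. x /\<^sub>R norm x)"

text \<open>For compact nonempty K the supremum is attained, so it is the maximum.\<close>

definition support_function :: "'a::euclidean_space set \<Rightarrow> 'a \<Rightarrow> real" where
  "support_function K u = (SUP x\<in>K. u \<bullet> x)"

definition width :: "'a::euclidean_space set \<Rightarrow> 'a \<Rightarrow> real" where
  "width K u = support_function K u + support_function K (- u)"

definition vert :: "'a::euclidean_space set \<Rightarrow> 'a set" where
  "vert Q = {q. q extreme_point_of Q}"

definition normal_cone :: "'a::euclidean_space set \<Rightarrow> 'a \<Rightarrow> 'a set" where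
  "normal_cone Q q = {y. \<forall>x\<in>Q. y \<bullet> x \<le> y \<bullet> q}"

definition normal_cell :: "'a::euclidean_space set \<Rightarrow> 'a \<Rightarrow> 'a set" where
  "normal_cell Q q = normal_cone Q q \<inter> sphere 0 1"

definition orthonormal_frame :: "real^3 \<Rightarrow> real^3 \<Rightarrow> real^3 \<Rightarrow> bool" where
  "orthonormal_frame q e1 e2 \<longleftrightarrow>
     norm e1 = 1 \<and> norm e2 = 1 \<and> e1 \<bullet> e2 = 0 \<and> span {e1, e2} = {x. q \<bullet> x = 0}"

definition level_point :: "real^3 \<Rightarrow> real^3 \<Rightarrow> real^3 \<Rightarrow> real \<Rightarrow> real \<Rightarrow> real^3" where
  "level_point q e1 e2 t \<theta> =
     (t / (norm q)\<^sup>2) *\<^sub>R q + sqrt (1 - t\<^sup>2 / (norm q)\<^sup>2) *\<^sub>R (cos \<theta> *\<^sub>R e1 + sin \<theta> *\<^sub>R e2)"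

text \<open>The aperture is extended by zero to the values of t whose level set is empty or a single
  point.\<close>

definition aperture :: "(real^3) set \<Rightarrow> real^3 \<Rightarrow> real^3 \<Rightarrow> real^3 \<Rightarrow> real \<Rightarrow> real" where
  "aperture Q q e1 e2 t =
     (if \<bar>t\<bar> < norm q
      then measure lebesgue {\<theta>\<in>{0..<2*pi}.
             level_point q e1 e2 t \<theta> \<in> top_of_set (sphere 0 1) interior_of normal_cell Q q}
      else 0)"

definition real_analytic_at :: "(real \<Rightarrow> real) \<Rightarrow> real \<Rightarrow> bool" where
  "real_analytic_at f x \<longleftrightarrow>
     (\<exists>a r. r > 0 \<and> (\<forall>y. \<bar>y - x\<bar> < r \<longrightarrow> (\<lambda>n. a n * (y - x) ^ n) sums f y))"

definition real_analytic_on :: "(real \<Rightarrow> real) \<Rightarrow> real set \<Rightarrow> bool" where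
  "real_analytic_on f S \<longleftrightarrow> (\<forall>x\<in>S. real_analytic_at f x)"

text \<open>The function continues one and the same analytic branch across t exactly if it is
  real-analytic at t.\<close>

definition branch_changes :: "(real \<Rightarrow> real) \<Rightarrow> real set" where
  "branch_changes f = {t. \<not> real_analytic_at f t}"

definition level_circle :: "real^3 \<Rightarrow> real \<Rightarrow> (real^3) set" where
  "level_circle q t = {u\<in>sphere 0 1. q \<bullet> u = t}"

definition great_circle :: "real^3 \<Rightarrow> (real^3) set" where
  "great_circle b = {u\<in>sphere 0 1. b \<bullet> u = 0}"

text \<open>The boundary arcs of a normal cell are the traces on the sphere of the two-dimensional faces
  of the normal cone, and its spherical vertices are the traces of the extreme rays.  The vector b
  is determined by the arc up to a nonzero factor, which does not affect the values below.\<close>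

definition supports_arc :: "(real^3) set \<Rightarrow> real^3 \<Rightarrow> real^3 \<Rightarrow> bool" where
  "supports_arc Q q b \<longleftrightarrow> b \<noteq> 0 \<and> (normal_cone Q q \<inter> {y. b \<bullet> y = 0}) facet_of normal_cone Q q"

definition boundary_arc :: "(real^3) set \<Rightarrow> real^3 \<Rightarrow> real^3 \<Rightarrow> (real^3) set" where
  "boundary_arc Q q b = normal_cell Q q \<inter> great_circle b"

definition spherical_vertex :: "(real^3) set \<Rightarrow> real^3 \<Rightarrow> real^3 \<Rightarrow> bool" where
  "spherical_vertex Q q v \<longleftrightarrow> norm v = 1 \<and> (conic hull {v}) face_of normal_cone Q q"

definition axial_values :: "real^3 \<Rightarrow> real set" where
  "axial_values q = {norm q, - norm q}"

definition arc_tangency_values :: "real^3 \<Rightarrow> real^3 \<Rightarrow> real set" where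
  "arc_tangency_values q b =
     (let b' = b /\<^sub>R norm b; p = q - (q \<bullet> b') *\<^sub>R b' in {norm p, - norm p})"

definition tangency_values :: "(real^3) set \<Rightarrow> real^3 \<Rightarrow> real set" where
  "tangency_values Q q = (\<Union>b\<in>{b. supports_arc Q q b}. arc_tangency_values q b)"

definition vertex_values :: "(real^3) set \<Rightarrow> real^3 \<Rightarrow> real set" where
  "vertex_values Q q = {q \<bullet> v | v. spherical_vertex Q q v}"

definition candidate_values :: "(real^3) set \<Rightarrow> real^3 \<Rightarrow> real set" where
  "candidate_values Q q = axial_values q \<union> tangency_values Q q \<union> vertex_values Q q"

text \<open>A level circle and a great circle are tangent at u if u is their only common point.\<close>

definition met_tangency_values :: "(real^3) set \<Rightarrow> real^3 \<Rightarrow> real set" where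
  "met_tangency_values Q q =
     {t. \<exists>b u. supports_arc Q q b \<and> t \<in> arc_tangency_values q b \<and>
           level_circle q t \<inter> great_circle b = {u} \<and> u \<in> boundary_arc Q q b}"

text \<open>Only tangency candidates can be discarded: the spherical vertices belong to the cell, and
  the axial values bound the range of t on which the level circle exists.\<close>

definition critical_values :: "(real^3) set \<Rightarrow> real^3 \<Rightarrow> real set" where
  "critical_values Q q = axial_values q \<union> met_tangency_values Q q \<union> vertex_values Q q"

end

theory Submission
  imports Defs "HOL-Complex_Analysis.Cauchy_Integral_Formula"
begin

text \<open>
  A direction lying in the interior of the normal cell of the vertex \<open>q\<close> has width \<open>q \<bullet> u\<close>, and
  almost every direction lies in exactly one such cell.  In cylindrical coordinates about the axis
  \<open>q\<close> the uniform distribution on the sphere is a multiple of the product of Lebesgue measures of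
  height and angle (Archimedes), so each cell contributes its aperture, rescaled by the norm
  of \<open>q\<close>.

  For the analyticity, fix a height that is not critical.  At every point where the level circle
  meets the boundary of the cell, exactly one facet of the normal cone is active (otherwise the point
  is a spherical vertex), and the circle crosses its plane transversally (otherwise the circle is
  tangent to the boundary arc).  So there are finitely many such points, each of them moves as an
  arc cosine of an analytic function of the height, and away from them membership in the cell
  is locally constant.
\<close>

subsection \<open>Real analytic functions\<close>

text \<open>Since \<open>uniform_sphere\<close> is a radial projection from the ball, no surface
  integral occurs: volumes in the ball are computed in radius, height and angle. The radial integral
  contributes 1/3 both to the part of the ball over a set of directions and to the whole ball, whose
  volume is \<open>4 * pi / 3\<close>; the quotient leaves \<open>1 / (4 * pi)\<close>.

  Full dimension of \<open>P\<close> puts a ball of some radius \<open>r\<close> about the origin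
  inside \<open>Q\<close>. It forces \<open>q \<bullet> u \<ge> r\<close> for every \<open>u\<close>
  in the cell of \<open>q\<close>, so apertures vanish below \<open>r\<close> and crossings matter
  only at positive height. At such a height a plane through the origin that meets the circle cannot
  be orthogonal to the axis, so its normal has a nonzero component across the axis, and the phase of
  the arc cosine is well defined.

  The obstacle is to pass from local statements at single angles to the measure of a whole period of
  angles. Local data are therefore rectangles in height and angle, and compactness extracts one
  neighbourhood of the height that serves all angles away from the crossings.\<close>

lemma real_analytic_at_holomorphic:
  assumes "F holomorphic_on ball (complex_of_real x) r" "r > 0"
    and eq: "\<And>y. \<bar>y - x\<bar> < r \<Longrightarrow> f y = Re (F (complex_of_real y))"
  shows "real_analytic_at f x"
proof -
  \<comment> \<open>The increment \<open>y - x\<close> is real, so taking real parts commutes with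
    multiplying by its powers; the real parts of the complex Taylor coefficients are coefficients
    for \<open>f\<close>.\<close>
  define a where "a n = Re ((deriv ^^ n) F (of_real x) / fact n)" for n
  have "(\<lambda>n. a n * (y - x) ^ n) sums f y" if "\<bar>y - x\<bar> < r" for y
  proof -
    have "complex_of_real y \<in> ball (of_real x) r"
      using that by (simp add: dist_real_def abs_minus_commute)
    from holomorphic_power_series[OF assms(1) this]
    have "(\<lambda>n. Re ((deriv ^^ n) F (of_real x) / fact n * (of_real y - of_real x) ^ n)) sums f y"
      using eq[OF that] by (simp add: sums_Re)
    moreover have "Re ((deriv ^^ n) F (of_real x) / fact n * (of_real y - of_real x) ^ n) = a n * (y - x) ^ n" for n
    proof -
      have "(of_real y - of_real x :: complex) ^ n = of_real ((y - x) ^ n)" by simp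
      then show ?thesis unfolding a_def by (simp only: Re_complex_of_real times_complex.sel Im_complex_of_real mult_zero_right diff_0_right)
    qed
    ultimately show ?thesis by simp
  qed
  then show ?thesis unfolding real_analytic_at_def using \<open>r > 0\<close> by blast
qed

lemma real_analytic_at_const: "real_analytic_at (\<lambda>_. c) x"
  by (rule real_analytic_at_holomorphic[of "\<lambda>_. of_real c" _ 1]) auto

lemma real_analytic_at_add:
  assumes "real_analytic_at f x" "real_analytic_at g x"
  shows "real_analytic_at (\<lambda>y. f y + g y) x"
proof -
  obtain a r where a: "r > 0" "\<And>y. \<bar>y - x\<bar> < r \<Longrightarrow> (\<lambda>n. a n * (y - x) ^ n) sums f y"
    using assms(1) unfolding real_analytic_at_def by blast
  obtain b s where b: "s > 0" "\<And>y. \<bar>y - x\<bar> < s \<Longrightarrow> (\<lambda>n. b n * (y - x) ^ n) sums g y"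
    using assms(2) unfolding real_analytic_at_def by blast
  have "(\<lambda>n. (a n + b n) * (y - x) ^ n) sums (f y + g y)" if "\<bar>y - x\<bar> < min r s" for y
    using sums_add[OF a(2) b(2), of y y] that by (simp add: distrib_right)
  then show ?thesis unfolding real_analytic_at_def using a(1) b(1)
    by (intro exI[of _ "\<lambda>n. a n + b n"] exI[of _ "min r s"]) simp
qed

lemma real_analytic_at_sum:
  assumes "\<And>i. i \<in> I \<Longrightarrow> real_analytic_at (f i) x"
  shows "real_analytic_at (\<lambda>y. \<Sum>i\<in>I. f i y) x"
  using assms
  by (induction I rule: infinite_finite_induct)
    (auto intro: real_analytic_at_const real_analytic_at_add)

lemma real_analytic_at_cong:
  assumes "real_analytic_at f x" and "eventually (\<lambda>y. f y = g y) (nhds x)"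
  shows "real_analytic_at g x"
proof -
  obtain a r where a: "r > 0" "\<And>y. \<bar>y - x\<bar> < r \<Longrightarrow> (\<lambda>n. a n * (y - x) ^ n) sums f y"
    using assms(1) unfolding real_analytic_at_def by blast
  obtain s where s: "s > 0" "\<And>y. dist y x < s \<Longrightarrow> f y = g y"
    using assms(2) unfolding eventually_nhds_metric by blast
  have "(\<lambda>n. a n * (y - x) ^ n) sums g y" if "\<bar>y - x\<bar> < min r s" for y
    using a(2)[of y] s(2)[of y] that by (simp add: dist_real_def)
  then show ?thesis unfolding real_analytic_at_def using a(1) s(1)
    by (intro exI[of _ a] exI[of _ "min r s"]) simp
qed

text \<open>This is the endpoint of an arc as a function of the height. Analyticity comes from a
  holomorphic extension to a small disc about \<open>t0\<close>, composed of principal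
  branches.\<close>

lemma real_analytic_at_arccos:
  fixes D k s t0 :: real
  assumes "\<bar>t0\<bar> < D" "\<bar>k * t0 / sqrt (D\<^sup>2 - t0\<^sup>2)\<bar> < 1"
  shows "real_analytic_at (\<lambda>t. s * arccos (k * t / sqrt (D\<^sup>2 - t\<^sup>2))) t0"
proof -
  define G where "G z = of_real k * z / csqrt ((of_real D)\<^sup>2 - z\<^sup>2)" for z :: complex
  have D2: "t\<^sup>2 < D\<^sup>2" if "\<bar>t\<bar> < D" for t
    using power_strict_mono[OF that, of 2] by simp
  have Greal: "G (of_real t) = of_real (k * t / sqrt (D\<^sup>2 - t\<^sup>2))" if "\<bar>t\<bar> < D" for t
  proof -
    have "(of_real D)\<^sup>2 - (of_real t)\<^sup>2 = (of_real (D\<^sup>2 - t\<^sup>2) :: complex)" by simp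
    moreover have "csqrt (of_real (D\<^sup>2 - t\<^sup>2)) = of_real (sqrt (D\<^sup>2 - t\<^sup>2))"
      using D2[OF that] by (intro of_real_sqrt[symmetric]) simp
    ultimately show ?thesis unfolding G_def by simp
  qed
  have csqrt_ne: "csqrt ((of_real D)\<^sup>2 - z\<^sup>2) \<noteq> 0" if "0 < Re ((of_real D)\<^sup>2 - z\<^sup>2)" for z :: complex
    using that by (metis csqrt_eq_0 less_irrefl zero_complex.simps(1))
  \<comment> \<open>Where the radicand has positive real part, it avoids the branch cut of
    \<open>csqrt\<close> and the denominator does not vanish.\<close>
  define W where "W = {z. 0 < Re ((of_real D)\<^sup>2 - z\<^sup>2)}"
  have W: "open W" unfolding W_def by (intro open_Collect_less continuous_intros)
  have holG: "G holomorphic_on W" unfolding G_def W_def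
    by (intro holomorphic_intros) (auto simp: csqrt_ne complex_nonpos_Reals_iff simp del: csqrt_eq_0)
  have contG: "continuous_on W G" using holG by (rule holomorphic_on_imp_continuous_on)
  \<comment> \<open>The branch cuts of \<open>Arccos\<close> lie on the real axis outside the open
    interval from -1 to 1, so this vertical strip avoids them.\<close>
  define V where "V = W \<inter> G -` {z. \<bar>Re z\<bar> < 1}"
  have "open {z. \<bar>Re z\<bar> < 1}" by (intro open_Collect_less continuous_intros)
  then have V: "open V" unfolding V_def by (rule continuous_open_preimage[OF contG W])
  have "of_real t0 \<in> V" using assms Greal[of t0] D2[OF assms(1)]
    by (auto simp: V_def W_def simp flip: of_real_power)
  then obtain r where r: "r > 0" "ball (of_real t0) r \<subseteq> V" using V open_contains_ball by blast
  \<comment> \<open>The second bound keeps real points of the disc inside the range where the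
    complex square root is the real one.\<close>
  define r' where "r' = min r (D - \<bar>t0\<bar>)"
  have r': "r' > 0" "ball (of_real t0) r' \<subseteq> V" using r assms(1) by (auto simp: r'_def)
  show ?thesis
  proof (rule real_analytic_at_holomorphic[where F = "\<lambda>z. of_real s * Arccos (G z)", OF _ r'(1)])
    have "(Arccos \<circ> G) holomorphic_on ball (of_real t0) r'"
    proof (rule holomorphic_on_compose_gen[where t = "{z. \<bar>Re z\<bar> < 1}"])
      show "G holomorphic_on ball (of_real t0) r'"
        by (rule holomorphic_on_subset[OF holG]) (use r' in \<open>auto simp: V_def\<close>)
      show "Arccos holomorphic_on {z. \<bar>Re z\<bar> < 1}" by (rule holomorphic_on_Arccos) auto
      show "G ` ball (of_real t0) r' \<subseteq> {z. \<bar>Re z\<bar> < 1}" using r' by (auto simp: V_def)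
    qed
    then show "(\<lambda>z. of_real s * Arccos (G z)) holomorphic_on ball (of_real t0) r'"
      by (intro holomorphic_intros) (simp add: o_def)
  next
    fix t :: real assume t: "\<bar>t - t0\<bar> < r'"
    then have tD: "\<bar>t\<bar> < D" by (auto simp: r'_def)
    have "of_real t \<in> V" using r'(2) t by (auto simp: dist_real_def abs_minus_commute subset_iff)
    then have "\<bar>k * t / sqrt (D\<^sup>2 - t\<^sup>2)\<bar> < 1" using Greal[OF tD] by (simp add: V_def)
    then show "s * arccos (k * t / sqrt (D\<^sup>2 - t\<^sup>2)) = Re (of_real s * Arccos (G (of_real t)))"
      unfolding Greal[OF tD] by (simp add: arccos_eq_Re_Arccos del: of_real_mult of_real_divide)
  qed
qed

text \<open>A component is determined by the set of points of \<open>S\<close> below any one of its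
  points, because two points with the same such set are joined by a segment missing
  \<open>S\<close>. So there are at most as many components as subsets of \<open>S\<close>.\<close>

lemma finite_components_compl:
  fixes S :: "real set"
  assumes "finite S"
  shows "finite (components (- S))"
proof -
  define C where "C A = connected_component_set (- S) (SOME x. x \<in> - S \<and> {s\<in>S. s < x} = A)" for A
  have "components (- S) \<subseteq> C ` Pow S"
  proof
    fix K assume "K \<in> components (- S)"
    then obtain x where x: "x \<in> - S" "K = connected_component_set (- S) x"
      unfolding components_def by blast
    define y where "y = (SOME y. y \<in> - S \<and> {s\<in>S. s < y} = {s\<in>S. s < x})"
    have "y \<in> - S \<and> {s\<in>S. s < y} = {s\<in>S. s < x}" unfolding y_def
      by (rule someI[of _ x]) (use x in auto)
    then have y: "y \<notin> S" "\<And>s. s \<in> S \<Longrightarrow> s < y \<longleftrightarrow> s < x" by auto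
    have "closed_segment y x \<subseteq> - S"
    proof
      fix z assume z: "z \<in> closed_segment y x"
      show "z \<in> - S"
      proof
        assume "z \<in> S"
        with y(1) y(2)[of z] x(1) z show False
          by (auto simp: closed_segment_eq_real_ivl split: if_splits)
      qed
    qed
    then have "connected_component (- S) y x"
      by (meson connected_component_def connected_segment ends_in_segment)
    then have "K = C {s\<in>S. s < x}" unfolding C_def x(2) y_def[symmetric]
      using connected_component_eq connected_component_sym mem_Collect_eq by metis
    then show "K \<in> C ` Pow S" by blast
  qed
  then show ?thesis using assms finite_surj by (metis finite_Pow_iff)
qed

subsection \<open>Measures of circular arcs\<close>

text \<open>Within the window the cosine is monotone, so the superlevel set is an interval with one
  end fixed at the window's edge and the other at distance \<open>arccos c\<close> from a maximum of
  the cosine. It lies on the side of that maximum, so \<open>arccos c\<close> enters with the same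
  sign on both slopes.\<close>

lemma arc_measure_arccos:
  fixes \<theta>0 \<phi> :: real
  assumes "sin (\<theta>0 - \<phi>) \<noteq> 0"
  obtains \<epsilon>0 where "\<epsilon>0 > 0"
    "\<And>\<epsilon>. 0 < \<epsilon> \<Longrightarrow> \<epsilon> < \<epsilon>0 \<Longrightarrow> \<exists>K. \<forall>\<^sub>F c in nhds (cos (\<theta>0 - \<phi>)).
        measure lebesgue {\<theta>\<in>{\<theta>0-\<epsilon>..\<theta>0+\<epsilon>}. c < cos (\<theta> - \<phi>)} = K + arccos c"
proof -
  define a where "a = arccos (cos (\<theta>0 - \<phi>))"
  have c1: "\<bar>cos (\<theta>0 - \<phi>)\<bar> < 1"
  proof (rule ccontr)
    assume "\<not> ?thesis"
    with abs_cos_le_one[of "\<theta>0 - \<phi>"] have "\<bar>cos (\<theta>0 - \<phi>)\<bar> = 1" by linarith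
    then have "(cos (\<theta>0 - \<phi>))\<^sup>2 = 1" by (metis one_power2 power2_abs)
    with assms show False using sin_cos_squared_add[of "\<theta>0 - \<phi>"] by simp
  qed
  then have a: "0 < a" "a < pi" unfolding a_def using arccos_lt_bounded[of "cos (\<theta>0 - \<phi>)"] by auto
  have "cos (\<theta>0 - \<phi>) = cos a" unfolding a_def using c1 by simp
  then obtain n where n: "n \<in> \<int>" "\<theta>0 - \<phi> = a + 2 * n * pi \<or> \<theta>0 - \<phi> = - a + 2 * n * pi"
    unfolding cos_eq by (auto simp: algebra_simps)
  \<comment> \<open>The maximum of \<open>cos (\<theta> - \<phi>)\<close> nearest to
    \<open>\<theta>0\<close>, at distance \<open>a\<close> strictly between 0 and
    \<open>pi\<close>.\<close>
  define p where "p = \<phi> + 2 * n * pi"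
  have cosp: "cos (\<theta> - \<phi>) = cos (\<theta> - p)" for \<theta>
  proof -
    have "cos (\<theta> - p + 2 * pi * n) = cos (\<theta> - p)"
      using n(1) by (simp add: cos_add cos_integer_2pi sin_integer_2pi)
    then show ?thesis by (simp add: p_def algebra_simps)
  qed
  have \<theta>0: "\<theta>0 = p + a \<or> \<theta>0 = p - a" using n(2) by (auto simp: p_def)
  show ?thesis
  proof (rule that[of "min a (pi - a)"])
    show "min a (pi - a) > 0" using a by simp
    fix \<epsilon> :: real assume \<epsilon>: "0 < \<epsilon>" "\<epsilon> < min a (pi - a)"
    have "isCont arccos (cos (\<theta>0 - \<phi>))" using c1 by (intro isCont_arccos) auto
    then have "filterlim arccos (nhds a) (nhds (cos (\<theta>0 - \<phi>)))"
      unfolding isCont_def a_def tendsto_at_iff_tendsto_nhds .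
    then have "\<forall>\<^sub>F c in nhds (cos (\<theta>0 - \<phi>)). arccos c \<in> {a-\<epsilon><..<a+\<epsilon>}"
      using \<epsilon>(1) by (intro topological_tendstoD) auto
    moreover have "\<forall>\<^sub>F c in nhds (cos (\<theta>0 - \<phi>)). c \<in> {-1<..<1}"
      using c1 by (intro eventually_nhds_in_open) auto
    ultimately have ev: "\<forall>\<^sub>F c in nhds (cos (\<theta>0 - \<phi>)). arccos c \<in> {a-\<epsilon><..<a+\<epsilon>} \<and> c \<in> {-1<..<1}"
      by (rule eventually_conj)
    have less: "c < cos x \<longleftrightarrow> x < arccos c" if "c \<in> {-1<..<1}" "x \<in> {a-\<epsilon>..a+\<epsilon>}" for c x
    proof -
      have "cos (arccos c) < cos x \<longleftrightarrow> x < arccos c"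
        by (rule cos_mono_less_eq) (use that \<epsilon> in \<open>auto intro: less_imp_le arccos_lbound arccos_ubound\<close>)
      then show ?thesis using that by simp
    qed
    from \<theta>0 show "\<exists>K. \<forall>\<^sub>F c in nhds (cos (\<theta>0 - \<phi>)).
        measure lebesgue {\<theta>\<in>{\<theta>0-\<epsilon>..\<theta>0+\<epsilon>}. c < cos (\<theta> - \<phi>)} = K + arccos c"
    proof
      assume *: "\<theta>0 = p + a"
      show ?thesis
      proof (intro exI[of _ "p - \<theta>0 + \<epsilon>"] eventually_mono[OF ev])
        fix c assume c: "arccos c \<in> {a-\<epsilon><..<a+\<epsilon>} \<and> c \<in> {-1<..<1}"
        have "{\<theta>\<in>{\<theta>0-\<epsilon>..\<theta>0+\<epsilon>}. c < cos (\<theta> - \<phi>)} = {\<theta>0-\<epsilon>..<p + arccos c}"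
          unfolding cosp using less[of c "_ - p"] c * by fastforce
        then show "measure lebesgue {\<theta>\<in>{\<theta>0-\<epsilon>..\<theta>0+\<epsilon>}. c < cos (\<theta> - \<phi>)} = p - \<theta>0 + \<epsilon> + arccos c"
          using c * by simp
      qed
    next
      assume *: "\<theta>0 = p - a"
      show ?thesis
      proof (intro exI[of _ "\<theta>0 + \<epsilon> - p"] eventually_mono[OF ev])
        fix c assume c: "arccos c \<in> {a-\<epsilon><..<a+\<epsilon>} \<and> c \<in> {-1<..<1}"
        have cosp': "cos (\<theta> - p) = cos (p - \<theta>)" for \<theta> by (metis cos_minus minus_diff_eq)
        have "{\<theta>\<in>{\<theta>0-\<epsilon>..\<theta>0+\<epsilon>}. c < cos (\<theta> - \<phi>)} = {p - arccos c<..\<theta>0+\<epsilon>}"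
          unfolding cosp cosp' using less[of c "p - _"] c * by fastforce
        then show "measure lebesgue {\<theta>\<in>{\<theta>0-\<epsilon>..\<theta>0+\<epsilon>}. c < cos (\<theta> - \<phi>)} = \<theta>0 + \<epsilon> - p + arccos c"
          using c * by simp
      qed
    qed
  qed
qed

text \<open>Lets a period be cut at any point: the piece \<open>{0..<a}\<close> is carried by one
  translation to \<open>{p..<a+p}\<close>.\<close>

lemma measure_periodic_shift:
  fixes S :: "real set"
  assumes S: "S \<in> sets lebesgue" and per: "\<And>x. x + p \<in> S \<longleftrightarrow> x \<in> S" and a: "0 \<le> a" "a \<le> p"
  shows "measure lebesgue ({0..<p} \<inter> S) = measure lebesgue ({a..<a+p} \<inter> S)"
proof -
  have fm: "{x..<y} \<inter> S \<in> fmeasurable lebesgue" for x y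
    using S by (intro bounded_set_imp_lmeasurable bounded_Int) auto
  have split: "measure lebesgue ({x..<z} \<inter> S) = measure lebesgue ({x..<y} \<inter> S) + measure lebesgue ({y..<z} \<inter> S)"
    if "x \<le> y" "y \<le> z" for x y z
  proof -
    have "{x..<z} \<inter> S = ({x..<y} \<inter> S) \<union> ({y..<z} \<inter> S)" using that by auto
    then show ?thesis by (simp only:) (subst measure_Un_AE, use fm in auto)
  qed
  have "(+) p ` ({0..<a} \<inter> S) = {p..<a+p} \<inter> S"
  proof (intro set_eqI iffI)
    fix x assume x: "x \<in> {p..<a+p} \<inter> S"
    then have "x - p \<in> {0..<a} \<inter> S" using per[of "x - p"] by auto
    then show "x \<in> (+) p ` ({0..<a} \<inter> S)" by (metis image_eqI add.commute diff_add_cancel)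
  qed (use per in \<open>auto simp: add.commute\<close>)
  then have "measure lebesgue ({p..<a+p} \<inter> S) = measure lebesgue ({0..<a} \<inter> S)"
    by (metis measure_translation)
  then show ?thesis using split[of 0 a p] split[of a p "a+p"] a by simp
qed

section \<open>From local behaviour at each angle to analyticity of a measure\<close>

text \<open>Constancy is demanded jointly in height and angle: finitely many such rectangles then
  cover a compact set of angles for all heights near \<open>t0\<close> at once.\<close>

definition locally_constant_membership :: "(real \<Rightarrow> real set) \<Rightarrow> real \<Rightarrow> real \<Rightarrow> bool" where
  "locally_constant_membership S t0 \<theta>0 \<longleftrightarrow>
     (\<exists>T V v. open T \<and> open V \<and> t0 \<in> T \<and> \<theta>0 \<in> V \<and> (\<forall>t\<in>T. \<forall>\<theta>\<in>V. (\<theta> \<in> S t) = v))"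

text \<open>The exceptional angles are isolated, hence finite in number in one period. Small
  intervals around them contribute analytic terms by hypothesis; on the rest of the period the set
  does not change with \<open>t\<close> near \<open>t0\<close>, so the contribution is
  constant.\<close>

lemma real_analytic_at_periodic_measure:
  fixes S :: "real \<Rightarrow> real set" and p t0 :: real
  defines "lc \<equiv> locally_constant_membership S t0"
  assumes p: "p > 0" and per: "\<And>t x. x + p \<in> S t \<longleftrightarrow> x \<in> S t"
    and meas: "\<And>t. S t \<in> sets lebesgue"
    and loc: "\<And>\<theta>0. lc \<theta>0 \<or> (\<exists>\<epsilon>0>0. (\<forall>\<theta>. \<theta> \<noteq> \<theta>0 \<longrightarrow> \<bar>\<theta> - \<theta>0\<bar> < \<epsilon>0 \<longrightarrow> lc \<theta>) \<and>
        (\<forall>\<epsilon>. 0 < \<epsilon> \<longrightarrow> \<epsilon> < \<epsilon>0 \<longrightarrow> real_analytic_at (\<lambda>t. measure lebesgue ({\<theta>0-\<epsilon>..\<theta>0+\<epsilon>} \<inter> S t)) t0))"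
  shows "real_analytic_at (\<lambda>t. measure lebesgue ({0..<p} \<inter> S t)) t0"
proof -
  have lcI: "lc \<theta>" if "open T" "open V" "t0 \<in> T" "\<theta> \<in> V" "\<And>t \<theta>. t \<in> T \<Longrightarrow> \<theta> \<in> V \<Longrightarrow> (\<theta> \<in> S t) = v" for \<theta> T V v
    unfolding lc_def locally_constant_membership_def using that
    by (intro exI[of _ T] exI[of _ V] exI[of _ v]) simp
  have lcD: "\<exists>T V v. open T \<and> open V \<and> t0 \<in> T \<and> \<theta> \<in> V \<and> (\<forall>t\<in>T. \<forall>\<theta>'\<in>V. (\<theta>' \<in> S t) = v)"
    if "lc \<theta>" for \<theta>
    using that unfolding lc_def locally_constant_membership_def .
  define B where "B = {\<theta>. \<not> lc \<theta>}"
  \<comment> \<open>A stable angle has a whole neighbourhood of stable angles, and an exceptional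
    one has only stable angles around it.\<close>
  have noislim: "\<not> z islimpt B" for z
  proof (cases "lc z")
    case True
    then obtain T V v where TV: "open T" "open V" "t0 \<in> T" "z \<in> V"
      "\<And>t \<theta>. t \<in> T \<Longrightarrow> \<theta> \<in> V \<Longrightarrow> (\<theta> \<in> S t) = v"
      using lcD by metis
    have "lc \<theta>" if "\<theta> \<in> V" for \<theta>
      using TV(1-3) that TV(5) by (rule lcI)
    then have "B \<inter> V = {}" by (auto simp: B_def)
    then show ?thesis using TV unfolding islimpt_def by blast
  next
    case False
    with loc[of z] obtain \<epsilon>0 where "\<epsilon>0 > 0" "\<forall>\<theta>. \<theta> \<noteq> z \<longrightarrow> \<bar>\<theta> - z\<bar> < \<epsilon>0 \<longrightarrow> lc \<theta>" by blast
    then show ?thesis unfolding islimpt_approachable B_def dist_real_def by (metis mem_Collect_eq)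
  qed
  have finB: "finite ({x..y} \<inter> B)" for x y
    by (rule finite_not_islimpt_in_compact[OF compact_Icc noislim])
  \<comment> \<open>The period is cut at a stable angle \<open>\<alpha>\<close>, so that no
    exceptional interval straddles its ends.\<close>
  have "infinite {0..p}" using p by simp
  then obtain \<alpha> where \<alpha>: "\<alpha> \<in> {0..p}" "\<alpha> \<notin> B" using finB[of 0 p]
    by (metis Int_iff finite_subset subsetI)
  have lc_per: "lc (\<theta> + p)" if "lc \<theta>" for \<theta>
  proof -
    from that obtain T V v where TV: "open T" "open V" "t0 \<in> T" "\<theta> \<in> V"
      "\<And>t \<theta>. t \<in> T \<Longrightarrow> \<theta> \<in> V \<Longrightarrow> (\<theta> \<in> S t) = v"
      using lcD by metis
    have "open ((+) p ` V)" using TV by (intro open_translation)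
    moreover have "(\<theta> \<in> S t) = v" if "t \<in> T" "\<theta> \<in> (+) p ` V" for t \<theta>
      using that TV(5) per by (auto simp: add.commute)
    moreover have "\<theta> + p \<in> (+) p ` V" using TV by (auto simp: add.commute)
    ultimately show ?thesis using TV(1,3) lcI by blast
  qed
  define F where "F = {\<alpha>..\<alpha>+p} \<inter> B"
  have F: "finite F" unfolding F_def by (rule finB)
  have "\<alpha> + p \<notin> B" using lc_per \<alpha>(2) by (auto simp: B_def)
  then have F\<alpha>: "\<alpha> < b" "b < \<alpha> + p" if "b \<in> F" for b
    using that \<alpha>(2) by (auto simp: F_def less_le)
  have "\<forall>b\<in>F. \<exists>\<epsilon>0>0. \<forall>\<epsilon>. 0 < \<epsilon> \<longrightarrow> \<epsilon> < \<epsilon>0 \<longrightarrow>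
      real_analytic_at (\<lambda>t. measure lebesgue ({b-\<epsilon>..b+\<epsilon>} \<inter> S t)) t0"
    using loc unfolding F_def B_def by blast
  then obtain \<epsilon>0 where \<epsilon>0: "\<And>b. b \<in> F \<Longrightarrow> \<epsilon>0 b > 0"
    "\<And>b \<epsilon>. b \<in> F \<Longrightarrow> 0 < \<epsilon> \<Longrightarrow> \<epsilon> < \<epsilon>0 b \<Longrightarrow>
      real_analytic_at (\<lambda>t. measure lebesgue ({b-\<epsilon>..b+\<epsilon>} \<inter> S t)) t0"
    by metis
  have small: "\<forall>\<^sub>F \<epsilon> in at_right 0. \<epsilon> < x" if "x > 0" for x :: real
    using that by (rule eventually_at_right_real[THEN eventually_mono]) auto
  \<comment> \<open>One radius for all exceptional angles: small enough for analyticity, for staying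
    inside the period, and for the intervals to be pairwise disjoint.\<close>
  have "\<forall>\<^sub>F \<epsilon> in at_right 0. \<forall>b\<in>F. \<epsilon> < \<epsilon>0 b \<and> \<epsilon> < b - \<alpha> \<and> \<epsilon> < \<alpha> + p - b \<and>
      (\<forall>b'\<in>F. b' \<noteq> b \<longrightarrow> \<epsilon> < \<bar>b' - b\<bar> / 2)"
  proof (intro eventually_ball_finite[OF F] ballI eventually_conj)
    fix b b' assume "b \<in> F" "b' \<in> F"
    show "\<forall>\<^sub>F \<epsilon> in at_right 0. b' \<noteq> b \<longrightarrow> \<epsilon> < \<bar>b' - b\<bar> / 2"
    proof (cases "b' = b")
      case False
      then show ?thesis using small[of "\<bar>b' - b\<bar> / 2"] by simp
    qed simp
  qed (use \<epsilon>0(1) F\<alpha> in \<open>auto intro!: small\<close>)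
  moreover have "\<forall>\<^sub>F \<epsilon> in at_right 0. (0::real) < \<epsilon>" by (simp add: eventually_at_right_less)
  ultimately have "\<forall>\<^sub>F \<epsilon> in at_right 0. 0 < \<epsilon> \<and> (\<forall>b\<in>F. \<epsilon> < \<epsilon>0 b \<and> \<epsilon> < b - \<alpha> \<and> \<epsilon> < \<alpha> + p - b \<and>
      (\<forall>b'\<in>F. b' \<noteq> b \<longrightarrow> \<epsilon> < \<bar>b' - b\<bar> / 2))" by (intro eventually_conj)
  from eventually_happens'[OF _ this] obtain \<epsilon> where \<epsilon>: "0 < \<epsilon>"
    "\<And>b. b \<in> F \<Longrightarrow> \<epsilon> < \<epsilon>0 b" "\<And>b. b \<in> F \<Longrightarrow> \<epsilon> < b - \<alpha>"  "\<And>b. b \<in> F \<Longrightarrow> \<epsilon> < \<alpha> + p - b"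
    "\<And>b b'. b \<in> F \<Longrightarrow> b' \<in> F \<Longrightarrow> b' \<noteq> b \<Longrightarrow> \<epsilon> < \<bar>b' - b\<bar> / 2" by auto
  define J where "J b = {b-\<epsilon>..b+\<epsilon>}" for b
  \<comment> \<open>\<open>R\<close> removes open intervals and is compact, for the covering
    argument; \<open>R0\<close> removes closed ones and is disjoint from every \<open>J b\<close>,
    for additivity. \<open>R0\<close> is contained in \<open>R\<close>.\<close>
  define R where "R = {\<alpha>..\<alpha>+p} - (\<Union>b\<in>F. {b-\<epsilon><..<b+\<epsilon>})"
  define R0 where "R0 = {\<alpha>..<\<alpha>+p} - (\<Union>b\<in>F. J b)"
  have "compact R" unfolding R_def by (intro compact_diff open_UN) auto
  have "lc \<theta>" if "\<theta> \<in> R" for \<theta>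
  proof -
    have "\<theta> \<notin> F" using that \<epsilon>(1) unfolding R_def by auto
    moreover have "\<theta> \<in> {\<alpha>..\<alpha>+p}" using that unfolding R_def by auto
    ultimately show ?thesis by (auto simp: F_def B_def)
  qed
  then have "\<forall>\<theta>\<in>R. \<exists>T V. open T \<and> open V \<and> t0 \<in> T \<and> \<theta> \<in> V \<and> (\<forall>t\<in>T. \<forall>\<theta>'\<in>V. \<theta>' \<in> S t \<longleftrightarrow> \<theta>' \<in> S t0)"
    using lcD by (intro ballI) metis
  from bchoice[OF this] obtain T where "\<forall>\<theta>\<in>R. \<exists>V. open (T \<theta>) \<and> open V \<and> t0 \<in> T \<theta> \<and> \<theta> \<in> V \<and>
      (\<forall>t\<in>T \<theta>. \<forall>\<theta>'\<in>V. \<theta>' \<in> S t \<longleftrightarrow> \<theta>' \<in> S t0)" ..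
  from bchoice[OF this] obtain V where TV0: "\<forall>\<theta>\<in>R. open (T \<theta>) \<and> open (V \<theta>) \<and> t0 \<in> T \<theta> \<and> \<theta> \<in> V \<theta> \<and>
      (\<forall>t\<in>T \<theta>. \<forall>\<theta>'\<in>V \<theta>. \<theta>' \<in> S t \<longleftrightarrow> \<theta>' \<in> S t0)" ..
  have TV: "\<And>\<theta>. \<theta> \<in> R \<Longrightarrow> open (T \<theta>)" "\<And>\<theta>. \<theta> \<in> R \<Longrightarrow> open (V \<theta>)"
    "\<And>\<theta>. \<theta> \<in> R \<Longrightarrow> t0 \<in> T \<theta>" "\<And>\<theta>. \<theta> \<in> R \<Longrightarrow> \<theta> \<in> V \<theta>"
    "\<And>\<theta> t \<theta>'. \<theta> \<in> R \<Longrightarrow> t \<in> T \<theta> \<Longrightarrow> \<theta>' \<in> V \<theta> \<Longrightarrow> \<theta>' \<in> S t \<longleftrightarrow> \<theta>' \<in> S t0"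
    by (use TV0 in blast)+
  obtain R' where R': "R' \<subseteq> R" "finite R'" "R \<subseteq> (\<Union>\<theta>\<in>R'. V \<theta>)"
    by (rule compactE_image[OF \<open>compact R\<close>, of R V]) (use TV in auto)
  have "\<forall>\<^sub>F t in nhds t0. \<forall>\<theta>\<in>R'. t \<in> T \<theta>"
    using R' TV by (intro eventually_ball_finite ballI eventually_nhds_in_open) auto
  then have const: "\<forall>\<^sub>F t in nhds t0. R0 \<inter> S t = R0 \<inter> S t0"
  proof eventually_elim
    case (elim t)
    have "(\<theta> \<in> S t) = (\<theta> \<in> S t0)" if "\<theta> \<in> R0" for \<theta>
    proof -
      have "\<theta> \<in> R" using that by (force simp: R_def R0_def J_def)
      then obtain r where "r \<in> R'" "\<theta> \<in> V r" using R'(3) by blast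
      then show ?thesis using TV(3,5) R'(1) elim by blast
    qed
    then show ?case by blast
  qed
  have eq: "measure lebesgue ({0..<p} \<inter> S t)
      = measure lebesgue (R0 \<inter> S t) + (\<Sum>b\<in>F. measure lebesgue (J b \<inter> S t))" for t
  proof -
    have "{\<alpha>..<\<alpha>+p} = R0 \<union> (\<Union>b\<in>F. J b)"
      using \<epsilon>(3,4) by (force simp: R0_def J_def)
    then have U: "{\<alpha>..<\<alpha>+p} \<inter> S t = (R0 \<inter> S t) \<union> (\<Union>b\<in>F. J b \<inter> S t)" by blast
    have fJ: "J b \<inter> S t \<in> fmeasurable lebesgue" for b
      unfolding J_def using meas by (intro bounded_set_imp_lmeasurable bounded_Int) auto
    have fR: "R0 \<inter> S t \<in> fmeasurable lebesgue"
      unfolding R0_def J_def using meas F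
      by (intro bounded_set_imp_lmeasurable bounded_Int bounded_diff disjI1 sets.Int sets.Diff sets.finite_UN) auto
    have fU: "(\<Union>b\<in>F. J b \<inter> S t) \<in> fmeasurable lebesgue"
      using F fJ by (intro fmeasurable.finite_UN) auto
    have "measure lebesgue ({0..<p} \<inter> S t) = measure lebesgue ({\<alpha>..<\<alpha>+p} \<inter> S t)"
      using \<alpha>(1) by (intro measure_periodic_shift meas per) auto
    also have "\<dots> = measure lebesgue (R0 \<inter> S t) + measure lebesgue (\<Union>b\<in>F. J b \<inter> S t)"
      unfolding U by (rule measure_Un_AE) (use fR fU in \<open>auto simp: R0_def\<close>)
    also have "measure lebesgue (\<Union>b\<in>F. J b \<inter> S t) = (\<Sum>b\<in>F. measure lebesgue (J b \<inter> S t))"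
    proof (rule measure_UNION'[OF F fJ])
      show "pairwise (\<lambda>i j. disjnt (J i \<inter> S t) (J j \<inter> S t)) F"
        unfolding pairwise_def disjnt_def J_def using \<epsilon>(5) by (fastforce simp: abs_if split: if_splits)
    qed
    finally show ?thesis .
  qed
  have "real_analytic_at (\<lambda>t. measure lebesgue (R0 \<inter> S t0) + (\<Sum>b\<in>F. measure lebesgue (J b \<inter> S t))) t0"
    by (intro real_analytic_at_add real_analytic_at_const real_analytic_at_sum)
      (use \<epsilon>(1,2) \<epsilon>0(2) in \<open>auto simp: J_def\<close>)
  then show ?thesis
    by (rule real_analytic_at_cong) (use const in eventually_elim, simp add: eq)
qed

subsection \<open>The uniform distribution on the sphere in height and angle\<close>

text \<open>The components of \<open>x\<close> are the radius, the height of the direction and the angle; in these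
  coordinates the Jacobian does not depend on the direction.\<close>

definition height_angle :: "real^3 \<Rightarrow> real^3" where
  "height_angle x = vector [x$1 * (sqrt (1 - (x$2)\<^sup>2) * cos (x$3)), x$1 * (sqrt (1 - (x$2)\<^sup>2) * sin (x$3)), x$1 * x$2]"

definition height_angle' :: "real^3 \<Rightarrow> real^3 \<Rightarrow> real^3" where
  "height_angle' x h = (let s = sqrt (1 - (x$2)\<^sup>2); s' = - (x$2 * h$2) / s in
     vector [h$1 * (s * cos (x$3)) + x$1 * (s' * cos (x$3) - s * sin (x$3) * h$3),
             h$1 * (s * sin (x$3)) + x$1 * (s' * sin (x$3) + s * cos (x$3) * h$3),
             h$1 * x$2 + x$1 * h$2])"

lemma has_derivative_vector_3:
  fixes f1 f2 f3 :: "'a::real_normed_vector \<Rightarrow> real"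
  assumes "(f1 has_derivative f1') F" "(f2 has_derivative f2') F" "(f3 has_derivative f3') F"
  shows "((\<lambda>x. vector [f1 x, f2 x, f3 x] :: real^3) has_derivative (\<lambda>h. vector [f1' h, f2' h, f3' h])) F"
proof -
  have *: "(vector [a, b, c] :: real^3) = a *\<^sub>R axis 1 1 + b *\<^sub>R axis 2 1 + c *\<^sub>R axis 3 1" for a b c
    by (simp add: vec_eq_iff forall_3 axis_def)
  show ?thesis unfolding * by (intro has_derivative_add has_derivative_scaleR_left assms)
qed

lemma height_angle_has_derivative:
  assumes "\<bar>x$2\<bar> < 1"
  shows "(height_angle has_derivative height_angle' x) (at x within S)"
proof -
  have pos: "0 < 1 - (x$2)\<^sup>2" using assms by (simp add: abs_square_less_1)
  have nth: "((\<lambda>x. x $ i) has_derivative (\<lambda>h. h $ i)) (at x within S)" for i :: 3 and x :: "real^3"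
    by (rule bounded_linear_imp_has_derivative[OF bounded_linear_vec_nth])
  have "((\<lambda>x. sqrt (1 - (x$2)\<^sup>2)) has_derivative
      (\<lambda>h. (0 - (x$2 * h$2 + h$2 * x$2)) * (inverse (sqrt (1 - (x$2)\<^sup>2)) / 2))) (at x within S)"
    unfolding power2_eq_square
    by (intro has_derivative_real_sqrt has_derivative_diff has_derivative_const has_derivative_mult nth pos[unfolded power2_eq_square])
  then have s: "((\<lambda>x. sqrt (1 - (x$2)\<^sup>2)) has_derivative
      (\<lambda>h. - (x$2 * h$2) / sqrt (1 - (x$2)\<^sup>2))) (at x within S)"
    by (rule has_derivative_eq_rhs) (simp add: fun_eq_iff divide_simps)
  have c: "((\<lambda>x. cos (x$3)) has_derivative (\<lambda>h. h$3 * - sin (x$3))) (at x within S)"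
    by (intro has_derivative_cos nth)
  have n: "((\<lambda>x. sin (x$3)) has_derivative (\<lambda>h. h$3 * cos (x$3))) (at x within S)"
    by (intro has_derivative_sin nth)
  show ?thesis unfolding height_angle_def[abs_def] height_angle'_def Let_def
  proof (rule has_derivative_vector_3)
    show "((\<lambda>x. x$1 * (sqrt (1 - (x$2)\<^sup>2) * cos (x$3))) has_derivative (\<lambda>h. h$1 * (sqrt (1 - (x$2)\<^sup>2) * cos (x$3))
        + x$1 * (- (x$2 * h$2) / sqrt (1 - (x$2)\<^sup>2) * cos (x$3) - sqrt (1 - (x$2)\<^sup>2) * sin (x$3) * h$3))) (at x within S)"
      by (rule has_derivative_eq_rhs[OF has_derivative_mult[OF nth has_derivative_mult[OF s c]]])
        (simp add: fun_eq_iff algebra_simps)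
    show "((\<lambda>x. x$1 * (sqrt (1 - (x$2)\<^sup>2) * sin (x$3))) has_derivative (\<lambda>h. h$1 * (sqrt (1 - (x$2)\<^sup>2) * sin (x$3))
        + x$1 * (- (x$2 * h$2) / sqrt (1 - (x$2)\<^sup>2) * sin (x$3) + sqrt (1 - (x$2)\<^sup>2) * cos (x$3) * h$3))) (at x within S)"
      by (rule has_derivative_eq_rhs[OF has_derivative_mult[OF nth has_derivative_mult[OF s n]]])
        (simp add: fun_eq_iff algebra_simps)
    show "((\<lambda>x. x$1 * x$2) has_derivative (\<lambda>h. h$1 * x$2 + x$1 * h$2)) (at x within S)"
      by (rule has_derivative_eq_rhs[OF has_derivative_mult[OF nth nth]]) (simp add: fun_eq_iff algebra_simps)
  qed
qed

text \<open>Archimedes' hat-box theorem in infinitesimal form: a parallel at height \<open>z\<close>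
  on the unit sphere shrinks by \<open>s\<close>, while a meridian is stretched by
  \<open>1 / s\<close> relative to height, and the two factors cancel.\<close>

lemma abs_det_height_angle':
  assumes "\<bar>x$2\<bar> < 1"
  shows "\<bar>det (matrix (height_angle' x))\<bar> = (x$1)\<^sup>2"
proof -
  define s where "s = sqrt (1 - (x$2)\<^sup>2)"
  have pos: "0 < 1 - (x$2)\<^sup>2" using assms by (simp add: abs_square_less_1)
  then have s: "s > 0" "s\<^sup>2 = 1 - (x$2)\<^sup>2" by (simp_all add: s_def)
  have 1: "axis j (1::real) $ i = (if i = j then 1 else 0)" for i j :: 3 by (simp add: axis_def)
  let ?z = "x$2" and ?r = "x$1" and ?c = "cos (x$3)" and ?n = "sin (x$3)"
  have "det (matrix (height_angle' x)) = ?z * (- ?r * ?z * ?r * (?c\<^sup>2 + ?n\<^sup>2)) - ?r * (?r * s\<^sup>2 * (?c\<^sup>2 + ?n\<^sup>2))"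
    using s(1) by (simp add: det_3 matrix_def height_angle'_def Let_def 1 flip: s_def
      del: sin_cos_squared_add sin_cos_squared_add2 sin_cos_squared_add3)
     (simp add: power2_eq_square algebra_simps del: sin_cos_squared_add sin_cos_squared_add2 sin_cos_squared_add3)
  also have "\<dots> = - (?r\<^sup>2 * (?z\<^sup>2 + s\<^sup>2))" by (simp add: power2_eq_square algebra_simps)
  finally show ?thesis by (simp add: s(2))
qed

text \<open>The radius is recovered as the norm, then the height; away from the poles
  \<open>s\<close> is positive, so cosine and sine fix the angle modulo \<open>2*pi\<close>.\<close>

lemma inj_on_height_angle: "inj_on height_angle {x. 0 < x$1 \<and> \<bar>x$2\<bar> < 1 \<and> x$3 \<in> {0..<2*pi}}"
proof (rule inj_onI)
  fix x y :: "real^3"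
  assume x: "x \<in> {x. 0 < x$1 \<and> \<bar>x$2\<bar> < 1 \<and> x$3 \<in> {0..<2*pi}}"
    and y: "y \<in> {x. 0 < x$1 \<and> \<bar>x$2\<bar> < 1 \<and> x$3 \<in> {0..<2*pi}}" and eq: "height_angle x = height_angle y"
  have norm_sq: "(z$1)\<^sup>2 = (height_angle z $ 1)\<^sup>2 + (height_angle z $ 2)\<^sup>2 + (height_angle z $ 3)\<^sup>2" if "\<bar>z$2\<bar> < 1" for z
  proof -
    have "0 < 1 - (z$2)\<^sup>2" using that by (simp add: abs_square_less_1)
    then have "(sqrt (1 - (z$2)\<^sup>2))\<^sup>2 = 1 - (z$2)\<^sup>2" by simp
    moreover have "(height_angle z $ 1)\<^sup>2 + (height_angle z $ 2)\<^sup>2 + (height_angle z $ 3)\<^sup>2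
      = (z$1)\<^sup>2 * ((sqrt (1 - (z$2)\<^sup>2))\<^sup>2 * ((cos (z$3))\<^sup>2 + (sin (z$3))\<^sup>2) + (z$2)\<^sup>2)"
      by (simp add: height_angle_def power_mult_distrib algebra_simps del: sin_cos_squared_add sin_cos_squared_add2)
    ultimately show ?thesis by simp
  qed
  have 1: "x$1 = y$1"
  proof (rule power2_eq_imp_eq)
    show "(x$1)\<^sup>2 = (y$1)\<^sup>2" using norm_sq[of x] norm_sq[of y] x y eq by simp
  qed (use x y in auto)
  have 2: "x$2 = y$2" using arg_cong[OF eq, of "\<lambda>v. v$3"] x 1 by (simp add: height_angle_def)
  have s: "sqrt (1 - (y$2)\<^sup>2) > 0" using y by (simp add: abs_square_less_1)
  have "cos (x$3) = cos (y$3)" using arg_cong[OF eq, of "\<lambda>v. v$1"] y 1 2 s by (simp add: height_angle_def)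
  moreover have "sin (x$3) = sin (y$3)" using arg_cong[OF eq, of "\<lambda>v. v$2"] y 1 2 s by (simp add: height_angle_def)
  ultimately obtain n :: int where n: "x$3 = y$3 + 2 * pi * n"
    using sin_cos_eq_iff[of "x$3" "y$3"] by (auto elim: Ints_cases)
  have "\<bar>2 * pi * n\<bar> < 2 * pi" using x y n by auto
  then have "\<bar>real_of_int n\<bar> < 1" by (simp add: abs_mult)
  then have "n = 0" by linarith
  with n have "x$3 = y$3" by simp
  with 1 2 show "x = y" by (simp add: vec_eq_iff forall_3)
qed

lemma measurable_vector_3:
  "(\<lambda>(a, b, c). vector [a, b, c] :: real^3) \<in> borel_measurable borel"
proof -
  have *: "(vector [a, b, c] :: real^3) = a *\<^sub>R axis 1 1 + b *\<^sub>R axis 2 1 + c *\<^sub>R axis 3 1" for a b c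
    by (simp add: vec_eq_iff forall_3 axis_def)
  show ?thesis unfolding * case_prod_beta
    by (intro borel_measurable_continuous_onI continuous_intros)
qed

text \<open>Makes Tonelli's theorem available in the coordinates of \<open>real^3\<close>. Boxes
  pull back to products of intervals, and their volumes characterise Lebesgue measure.\<close>

lemma lborel_vec3:
  "(lborel :: (real^3) measure) = distr lborel borel (\<lambda>(a, b, c). vector [a, b, c])"
proof (rule lborel_eqI)
  note measurable_vector_3 [measurable]
  fix l u :: "real^3" assume le: "\<And>b. b \<in> Basis \<Longrightarrow> l \<bullet> b \<le> u \<bullet> b"
  have le': "l $ i \<le> u $ i" for i
    using le[of "axis i 1"] by (simp add: inner_axis axis_in_Basis_iff)
  have vim: "(\<lambda>(a, b, c). vector [a, b, c]) -` box l u = {l$1<..<u$1} \<times> {l$2<..<u$2} \<times> {l$3<..<u$3}"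
  proof (rule set_eqI)
    fix p :: "real \<times> real \<times> real"
    obtain a b c where p: "p = (a, b, c)" by (cases p)
    show "p \<in> (\<lambda>(a, b, c). vector [a, b, c]) -` box l u \<longleftrightarrow> p \<in> {l$1<..<u$1} \<times> {l$2<..<u$2} \<times> {l$3<..<u$3}"
      unfolding p vimage_eq prod.case mem_box_cart forall_3 vector_3 mem_Times_iff fst_conv snd_conv greaterThanLessThan_iff ..
  qed
  have "emeasure (distr lborel borel (\<lambda>(a, b, c). vector [a, b, c])) (box l u)
      = emeasure (lborel \<Otimes>\<^sub>M (lborel \<Otimes>\<^sub>M lborel)) ({l$1<..<u$1} \<times> {l$2<..<u$2} \<times> {l$3<..<u$3})"
    by (subst emeasure_distr) (auto simp: vim lborel_prod)
  also have "\<dots> = ennreal (u$1 - l$1) * (ennreal (u$2 - l$2) * ennreal (u$3 - l$3))"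
    using le' by (simp add: lborel_pair.emeasure_pair_measure_Times lborel.emeasure_pair_measure_Times)
  also have "\<dots> = ennreal ((u$1 - l$1) * (u$2 - l$2) * (u$3 - l$3))"
    using le' by (simp add: ennreal_mult mult.assoc)
  also have "(u$1 - l$1) * (u$2 - l$2) * (u$3 - l$3) = (\<Prod>b\<in>Basis. (u - l) \<bullet> b)"
  proof -
    have "(Basis :: (real^3) set) = {axis 1 1, axis 2 1, axis 3 1}"
      unfolding Basis_vec_def UNIV_3 by auto
    then have "(\<Prod>b\<in>Basis. (u - l) \<bullet> b) = (\<Prod>b\<in>{axis 1 1, axis 2 1, axis 3 1}. (u - l) \<bullet> b)"
      by (rule prod.cong) simp
    also have "\<dots> = (u$1 - l$1) * (u$2 - l$2) * (u$3 - l$3)"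
      by (simp add: axis_eq_axis inner_axis mult.assoc)
    finally show ?thesis by simp
  qed
  finally show "emeasure (distr lborel borel (\<lambda>(a, b, c). vector [a, b, c])) (box l u) = (\<Prod>b\<in>Basis. (u - l) \<bullet> b)" .
qed (rule sets_distr)

text \<open>Change of variables with Jacobian \<open>(x$1)\<^sup>2\<close>: the integrand separates,
  and the factor 1/3 is the integral of the squared radius from 0 to 1.\<close>

lemma measure_height_angle_image:
  fixes B :: "(real \<times> real) set"
  assumes B: "B \<in> sets borel" "B \<subseteq> {-1<..<1} \<times> {0..<2*pi}"
  defines "S \<equiv> {x. 0 < x$1 \<and> x$1 < 1 \<and> (x$2, x$3) \<in> B}"
  shows "height_angle ` S \<in> lmeasurable" "measure lebesgue (height_angle ` S) = measure lborel B / 3"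
proof -
  have nth: "(\<lambda>x. x $ i) \<in> borel_measurable (borel :: (real^3) measure)" for i
    by (intro borel_measurable_continuous_onI continuous_intros)
  have pair: "(\<lambda>x. (x$2, x$3)) \<in> measurable (borel :: (real^3) measure) borel"
    by (intro borel_measurable_continuous_onI continuous_intros)
  have "S = {x. 0 < x$1 \<and> x$1 < 1} \<inter> (\<lambda>x. (x$2, x$3)) -` B" by (auto simp: S_def)
  moreover have "{x::real^3. 0 < x$1 \<and> x$1 < 1} \<in> sets borel" using nth[of 1] by measurable
  ultimately have S: "S \<in> sets borel" using measurable_sets[OF pair B(1)] by auto
  have fin: "emeasure lborel B = ennreal (measure lborel B)"
  proof (rule emeasure_eq_ennreal_measure)
    have "bounded B" by (rule bounded_subset[OF _ B(2)]) (auto intro: bounded_Times)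
    then show "emeasure lborel B \<noteq> top" using emeasure_bounded_finite by fastforce
  qed
  have "((\<lambda>x::real. x\<^sup>2) has_integral (1^3/3 - 0^3/3)) {0..1}"
    by (rule fundamental_theorem_of_calculus)
      (auto intro!: derivative_eq_intros simp: has_real_derivative_iff_has_vector_derivative[symmetric] power2_eq_square)
  then have "((\<lambda>x::real. x\<^sup>2) has_integral (1/3)) {0<..<1}"
    by (simp add: has_integral_Icc_iff_Ioo)
  then have I1: "(\<integral>\<^sup>+x. ennreal (x\<^sup>2) * indicator {0<..<1} x \<partial>lborel) = ennreal (1/3)"
    by (intro nn_integral_has_integral_lebesgue') auto
  have "(\<integral>\<^sup>+x. ennreal (indicator S x * (x$1)\<^sup>2) \<partial>lborel)
      = (\<integral>\<^sup>+p. ennreal (indicator S (case p of (a,b,c) \<Rightarrow> vector [a,b,c]) * ((case p of (a,b,c) \<Rightarrow> (vector [a,b,c] :: real^3))$1)\<^sup>2) \<partial>lborel)"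
    unfolding lborel_vec3 by (rule nn_integral_distr) (use S nth[of 1] measurable_vector_3 in \<open>auto intro!: measurable_compose[OF _ nth[of 1]]\<close>)
  also have "\<dots> = (\<integral>\<^sup>+p. ennreal ((fst p)\<^sup>2) * indicator {0<..<1} (fst p) * indicator B (snd p) \<partial>lborel)"
    by (intro nn_integral_cong) (auto simp: S_def indicator_def)
  also have "\<dots> = (\<integral>\<^sup>+a. (\<integral>\<^sup>+p. ennreal (a\<^sup>2) * indicator {0<..<1} a * indicator B p \<partial>lborel) \<partial>lborel)"
  proof -
    have "(\<lambda>p. ennreal ((fst p)\<^sup>2) * indicator {0<..<1} (fst p) * indicator B (snd p)) \<in> borel_measurable (lborel \<Otimes>\<^sub>M (lborel :: (real \<times> real) measure))"
      using B(1) by measurable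
    from lborel.nn_integral_fst[OF this] show ?thesis by (simp add: lborel_prod)
  qed
  also have "\<dots> = (\<integral>\<^sup>+a. ennreal (a\<^sup>2) * indicator {0<..<1} a * emeasure lborel B \<partial>lborel)"
    using B(1) by (intro nn_integral_cong) (simp add: nn_integral_cmult)
  also have "\<dots> = ennreal (1/3) * emeasure lborel B"
    by (subst nn_integral_multc) (simp_all add: I1)
  also have "\<dots> = ennreal (measure lborel B / 3)" unfolding fin by (simp flip: ennreal_mult')
  finally have nn: "(\<integral>\<^sup>+x. ennreal (indicator S x * (x$1)\<^sup>2) \<partial>lborel) = ennreal (measure lborel B / 3)" .
  have "((\<lambda>x. indicator S x * (x$1)\<^sup>2) has_integral measure lborel B / 3) UNIV"
    by (rule nn_integral_has_integral) (use nn S nth[of 1] in auto)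
  then have "((\<lambda>x. if x \<in> S then (x$1)\<^sup>2 else 0) has_integral measure lborel B / 3) UNIV"
    by (rule has_integral_eq[rotated]) simp
  then have "((\<lambda>x. (x$1)\<^sup>2) has_integral measure lborel B / 3) S"
    by (simp add: has_integral_restrict_UNIV)
  moreover have Sx: "\<bar>x$2\<bar> < 1" if "x \<in> S" for x using that subsetD[OF B(2), of "(x$2, x$3)"] by (auto simp: S_def)
  ultimately have hi: "((\<lambda>x. \<bar>det (matrix (height_angle' x))\<bar>) has_integral measure lborel B / 3) S"
    by (subst has_integral_cong[OF abs_det_height_angle']) auto
  have inj: "inj_on height_angle S" by (rule inj_on_subset[OF inj_on_height_angle]) (use Sx B(2) in \<open>auto simp: S_def\<close>)
  have S': "S \<in> sets lebesgue" using S by simp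
  note der = height_angle_has_derivative[OF Sx]
  show "height_angle ` S \<in> lmeasurable"
    using measurable_differentiable_image_eq[OF S' der inj] hi by blast
  show "measure lebesgue (height_angle ` S) = measure lborel B / 3"
    using measure_differentiable_image_eq[OF S' der inj] hi by (simp add: has_integral_iff)
qed

section \<open>Cylindrical coordinates about an arbitrary axis\<close>

locale orthonormal_triple =
  fixes e1 e2 e3 :: "real^3"
  assumes unit: "e1 \<bullet> e1 = 1" "e2 \<bullet> e2 = 1" "e3 \<bullet> e3 = 1"
    and orth: "e1 \<bullet> e2 = 0" "e1 \<bullet> e3 = 0" "e2 \<bullet> e3 = 0"
begin

text \<open>No orientation is fixed: \<open>T\<close> may include a reflection, which preserves
  volume as well.\<close>

definition T :: "real^3 \<Rightarrow> real^3" where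
  "T x = x$1 *\<^sub>R e1 + x$2 *\<^sub>R e2 + x$3 *\<^sub>R e3"

lemma orthogonal_T: "orthogonal_transformation T"
  unfolding orthogonal_transformation_def
proof
  show "linear T" by (rule linearI) (simp_all add: T_def algebra_simps)
  show "\<forall>v w. T v \<bullet> T w = v \<bullet> w"
  proof (intro allI)
    fix v w :: "real^3"
    have "v \<bullet> w = v$1 * w$1 + v$2 * w$2 + v$3 * w$3" by (simp add: inner_vec_def sum_3)
    then show "T v \<bullet> T w = v \<bullet> w"
      using unit orth by (simp add: T_def inner_add inner_commute[of e2 e1] inner_commute[of e3 e1] inner_commute[of e3 e2])
  qed
qed

definition \<psi> :: "real \<times> real \<Rightarrow> real^3" where
  "\<psi> p = sqrt (1 - (fst p)\<^sup>2) *\<^sub>R (cos (snd p) *\<^sub>R e1 + sin (snd p) *\<^sub>R e2) + fst p *\<^sub>R e3"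

lemma T_height_angle: "T (height_angle x) = x$1 *\<^sub>R \<psi> (x$2, x$3)"
  by (simp add: T_def height_angle_def \<psi>_def algebra_simps)

lemma norm_\<psi>: "\<bar>fst p\<bar> \<le> 1 \<Longrightarrow> norm (\<psi> p) = 1"
proof -
  assume "\<bar>fst p\<bar> \<le> 1"
  then have 1: "(fst p)\<^sup>2 \<le> 1" by (simp add: abs_square_le_1)
  have "\<psi> p = T (height_angle (vector [1, fst p, snd p]))" by (simp add: T_height_angle)
  then have "norm (\<psi> p) = norm (height_angle (vector [1, fst p, snd p]))"
    using orthogonal_T by (simp add: orthogonal_transformation)
  also have "\<dots> = sqrt ((1 - (fst p)\<^sup>2) * ((cos (snd p))\<^sup>2 + (sin (snd p))\<^sup>2) + (fst p)\<^sup>2)"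
    using 1 by (simp add: norm_vec_def L2_set_def sum_3 height_angle_def power_mult_distrib algebra_simps del: sin_cos_squared_add sin_cos_squared_add2)
  finally show ?thesis by simp
qed

lemma measurable_\<psi>: "\<psi> \<in> borel_measurable borel"
  unfolding \<psi>_def[abs_def] by (intro borel_measurable_continuous_onI continuous_intros)

lemma expansion: "x = (x \<bullet> e1) *\<^sub>R e1 + (x \<bullet> e2) *\<^sub>R e2 + (x \<bullet> e3) *\<^sub>R e3"
proof -
  have "surj T" using orthogonal_T orthogonal_transformation_surj by blast
  then obtain y where y: "x = T y" by blast
  have "x \<bullet> e1 = y$1" "x \<bullet> e2 = y$2" "x \<bullet> e3 = y$3"
    using unit orth by (simp_all add: y T_def inner_add inner_commute)
  then show ?thesis using y by (simp add: T_def)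
qed

text \<open>The hypothesis keeps \<open>x\<close> off the axis \<open>e3\<close>, where the angle
  would be undefined; the excluded plane is a null set.\<close>

lemma cylindrical_coordinates:
  assumes "x \<bullet> e2 \<noteq> 0"
  obtains z \<theta> where "\<bar>z\<bar> < 1" "0 \<le> \<theta>" "\<theta> < 2*pi" "x = norm x *\<^sub>R \<psi> (z, \<theta>)"
proof -
  define r where "r = norm x"
  have r: "r > 0" using assms unfolding r_def by auto
  have sq: "r\<^sup>2 = (x \<bullet> e1)\<^sup>2 + (x \<bullet> e2)\<^sup>2 + (x \<bullet> e3)\<^sup>2"
    unfolding r_def power2_norm_eq_inner
    by (subst (1 2) expansion) (use unit orth in \<open>simp add: inner_add inner_commute power2_eq_square algebra_simps\<close>)
  define z where "z = (x \<bullet> e3) / r"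
  have "(x \<bullet> e3)\<^sup>2 < r\<^sup>2" using sq assms zero_less_power2[of "x \<bullet> e2"] zero_le_power2[of "x \<bullet> e1"] by linarith
  then have z2: "z\<^sup>2 < 1" using r by (simp add: z_def power_divide)
  then have z: "\<bar>z\<bar> < 1" by (simp add: abs_square_less_1)
  define s where "s = sqrt (1 - z\<^sup>2)"
  have s: "s > 0" "s\<^sup>2 = 1 - z\<^sup>2" using z2 by (simp_all add: s_def)
  have "(r * s)\<^sup>2 = (x \<bullet> e1)\<^sup>2 + (x \<bullet> e2)\<^sup>2"
  proof -
    have "(r * s)\<^sup>2 = r\<^sup>2 - (x \<bullet> e3)\<^sup>2"
      using r by (simp add: power_mult_distrib s(2) z_def power_divide field_simps)
    then show ?thesis by (simp add: sq)
  qed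
  with r s have "((x \<bullet> e1) / (r * s))\<^sup>2 + ((x \<bullet> e2) / (r * s))\<^sup>2 = 1"
    by (metis add_divide_distrib divide_self_if mult_eq_0_iff order_less_irrefl power_divide power_not_zero)
  then obtain \<theta> where \<theta>: "0 \<le> \<theta>" "\<theta> < 2*pi" "(x \<bullet> e1) / (r * s) = cos \<theta>" "(x \<bullet> e2) / (r * s) = sin \<theta>"
    by (metis sincos_total_2pi)
  then have "x \<bullet> e1 = r * s * cos \<theta>" "x \<bullet> e2 = r * s * sin \<theta>" "x \<bullet> e3 = r * z"
    using r s by (simp_all add: field_simps z_def)
  then have "x = r *\<^sub>R \<psi> (z, \<theta>)"
    by (subst expansion) (simp add: \<psi>_def algebra_simps flip: s_def)
  then show ?thesis using that[OF z \<theta>(1,2)] by (simp add: r_def)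
qed

definition R :: "(real \<times> real) set" where "R = {-1<..<1} \<times> {0..<2*pi}"

lemma R_borel: "R \<in> sets borel"
  unfolding R_def borel_prod[symmetric] by (intro pair_measureI) auto

text \<open>Up to a subset of the plane orthogonal to \<open>e2\<close>, the part of the ball over
  the directions in \<open>X\<close> is a rotated image of unit radius range times
  \<open>B\<close>.\<close>

lemma measure_ball_sector:
  assumes X: "X \<in> sets borel"
  shows "emeasure lborel {x \<in> ball 0 1. x /\<^sub>R norm x \<in> X} = ennreal (measure lborel {p\<in>R. \<psi> p \<in> X} / 3)"
proof -
  define B where "B = {p\<in>R. \<psi> p \<in> X}"
  note R_borel
  then have B: "B \<in> sets borel" "B \<subseteq> {-1<..<1} \<times> {0..<2*pi}"
    using measurable_sets[OF measurable_\<psi> X] by (auto simp: B_def R_def Collect_conj_eq vimage_def)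
  define S :: "(real^3) set" where "S = {x. 0 < x$1 \<and> x$1 < 1 \<and> (x$2, x$3) \<in> B}"
  note height_angle = measure_height_angle_image[OF B, folded S_def]
  define A where "A = {x \<in> ball 0 1. x /\<^sub>R norm x \<in> X}"
  have "(\<lambda>x::real^3. x /\<^sub>R norm x) \<in> borel_measurable borel" by measurable
  from measurable_sets[OF this X] have A: "A \<in> sets borel"
    by (auto simp: A_def Collect_conj_eq vimage_def ball_def[symmetric] Int_def[symmetric])
  have TS: "T ` height_angle ` S \<in> lmeasurable" "measure lebesgue (T ` height_angle ` S) = measure lborel B / 3"
    using measurable_orthogonal_image[OF orthogonal_T height_angle(1)] measure_orthogonal_image[OF orthogonal_T height_angle(1)] height_angle(2) by simp_all
  have sub: "T ` height_angle ` S \<subseteq> A"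
  proof clarify
    fix x assume x: "x \<in> S"
    then have "norm (\<psi> (x$2, x$3)) = 1" using subsetD[OF B(2), of "(x$2, x$3)"] by (intro norm_\<psi>) (auto simp: S_def)
    then show "T (height_angle x) \<in> A" using x by (auto simp: T_height_angle A_def S_def B_def)
  qed
  have N: "A - T ` height_angle ` S \<subseteq> {x. e2 \<bullet> x = 0}"
  proof (clarify, rule ccontr)
    fix x assume x: "x \<in> A" "x \<notin> T ` height_angle ` S" and "e2 \<bullet> x \<noteq> 0"
    then have nz: "x \<bullet> e2 \<noteq> 0" by (simp add: inner_commute)
    then obtain z \<theta> where c: "\<bar>z\<bar> < 1" "0 \<le> \<theta>" "\<theta> < 2*pi" "x = norm x *\<^sub>R \<psi> (z, \<theta>)"
      by (rule cylindrical_coordinates)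
    have r: "norm x > 0" "norm x < 1" using x(1) nz by (auto simp: A_def)
    define y :: "real^3" where "y = vector [norm x, z, \<theta>]"
    have "x = T (height_angle y)" using c(4) by (simp add: T_height_angle y_def)
    moreover have "x /\<^sub>R norm x = \<psi> (z, \<theta>)" using r by (subst c(4)) simp
    then have "y \<in> S" using x(1) c r by (auto simp: y_def S_def B_def R_def A_def)
    ultimately show False using x(2) by blast
  qed
  have "negligible {x. e2 \<bullet> x = 0}" using unit by (intro negligible_hyperplane) auto
  then have "negligible (A - T ` height_angle ` S)" using N negligible_subset by blast
  then have "emeasure lebesgue A = emeasure lebesgue (T ` height_angle ` S)"
    using sub A TS(1) by (intro emeasure_eq_AE) (auto simp: negligible_iff_null_sets fmeasurableD elim!: eventually_mono[OF AE_not_in])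
  also have "\<dots> = ennreal (measure lborel B / 3)"
    using TS by (simp add: emeasure_eq_measure2)
  finally show ?thesis using A by (simp add: A_def B_def)
qed

lemma emeasure_R: "emeasure lborel R = ennreal (4 * pi)"
proof -
  have "emeasure lborel R = ennreal 2 * ennreal (2 * pi)"
    unfolding R_def lborel_prod[symmetric] by (subst lborel.emeasure_pair_measure_Times) auto
  also have "\<dots> = ennreal (2 * (2 * pi))" by (rule ennreal_mult[symmetric]) simp_all
  finally show ?thesis by simp
qed

lemma emeasure_uniform_sphere:
  assumes X: "X \<in> sets borel"
  shows "emeasure uniform_sphere X = ennreal (1 / (4 * pi)) * emeasure lborel {p\<in>R. \<psi> p \<in> X}"
proof -
  have meas: "(\<lambda>x::real^3. x /\<^sub>R norm x) \<in> borel_measurable borel" by measurable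
  have B: "{p\<in>R. \<psi> p \<in> X} \<in> sets lborel"
    using measurable_sets[OF measurable_\<psi> X] R_borel by (auto simp: Collect_conj_eq vimage_def)
  have "emeasure lborel {p\<in>R. \<psi> p \<in> X} \<le> emeasure lborel R"
    by (rule emeasure_mono) (use R_borel in auto)
  then have fin: "emeasure lborel {p\<in>R. \<psi> p \<in> X} = ennreal (measure lborel {p\<in>R. \<psi> p \<in> X})"
    by (intro emeasure_eq_ennreal_measure) (auto simp: emeasure_R top_unique)
  have mR: "measure lborel R = 4 * pi" using emeasure_R by (simp add: measure_def)
  \<comment> \<open>All directions at once: this is the volume of the unit ball, the normalising
    constant in \<open>uniform_sphere\<close>.\<close>
  have ball: "emeasure lborel (ball (0::real^3) 1) = ennreal (4 * pi / 3)"
    using measure_ball_sector[of UNIV] by (simp add: mR ball_def)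
  have "emeasure uniform_sphere X = emeasure (uniform_measure lborel (ball 0 1)) ((\<lambda>x. x /\<^sub>R norm x) -` X)"
    unfolding uniform_sphere_def using X meas by (subst emeasure_distr) auto
  also have "\<dots> = emeasure lborel (ball 0 1 \<inter> (\<lambda>x. x /\<^sub>R norm x) -` X) / emeasure lborel (ball (0::real^3) 1)"
    using measurable_sets[OF meas X] by (intro emeasure_uniform_measure) auto
  also have "ball 0 1 \<inter> (\<lambda>x. x /\<^sub>R norm x) -` X = {x \<in> ball 0 1. x /\<^sub>R norm x \<in> X}" by auto
  also have "emeasure lborel \<dots> / emeasure lborel (ball (0::real^3) 1)
      = ennreal (measure lborel {p\<in>R. \<psi> p \<in> X} / 3 / (4 * pi / 3))"
    unfolding measure_ball_sector[OF X] ball by (intro divide_ennreal) auto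
  also have "\<dots> = ennreal (1 / (4 * pi)) * ennreal (measure lborel {p\<in>R. \<psi> p \<in> X})"
    by (simp flip: ennreal_mult)
  finally show ?thesis unfolding fin .
qed

end

lemma sets_pair_borel:
  "sets (borel \<Otimes>\<^sub>M lborel) = sets (borel :: ('a::euclidean_space \<times> 'b::euclidean_space) measure)"
  "sets (lborel \<Otimes>\<^sub>M lborel) = sets (borel :: ('a \<times> 'b) measure)"
  by (metis borel_prod sets_lborel sets_pair_measure_cong)+

section \<open>Disintegration of the sphere along level circles\<close>

text \<open>The aperture of an arbitrary set of directions. With the open normal cone as
  \<open>N\<close> it equals \<open>aperture\<close>, while the integral formula below asks only
  that \<open>N\<close> be Borel.\<close>

definition circle_aperture :: "(real^3) set \<Rightarrow> real^3 \<Rightarrow> real^3 \<Rightarrow> real^3 \<Rightarrow> real \<Rightarrow> real" where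
  "circle_aperture N q e1 e2 t =
     (if \<bar>t\<bar> < norm q then measure lebesgue {\<theta>\<in>{0..<2*pi}. level_point q e1 e2 t \<theta> \<in> N} else 0)"

lemma circle_aperture_nonneg: "circle_aperture N q e1 e2 t \<ge> 0"
  by (simp add: circle_aperture_def)

lemma orthonormal_frame_inner:
  assumes "orthonormal_frame q e1 e2"
  shows "e1 \<bullet> e1 = 1" "e2 \<bullet> e2 = 1" "e1 \<bullet> e2 = 0" "e1 \<bullet> q = 0" "e2 \<bullet> q = 0"
proof -
  have "e1 \<in> span {e1, e2}" "e2 \<in> span {e1, e2}" by (auto intro: span_base)
  then show "e1 \<bullet> e1 = 1" "e2 \<bullet> e2 = 1" "e1 \<bullet> e2 = 0" "e1 \<bullet> q = 0" "e2 \<bullet> q = 0"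
    using assms unfolding orthonormal_frame_def by (auto simp: norm_eq_1 inner_commute)
qed

context
  fixes q e1 e2 :: "real^3" and N :: "(real^3) set"
  assumes frame: "orthonormal_frame q e1 e2" and q: "q \<noteq> 0" and N: "N \<in> sets borel"
begin

lemma level_point_measurable:
  "(\<lambda>(t, \<theta>). level_point q e1 e2 t \<theta>) \<in> borel_measurable borel"
  unfolding level_point_def case_prod_beta
  by (intro borel_measurable_continuous_onI continuous_intros) (use q in auto)

lemma emeasure_circle_aperture:
  assumes "\<bar>t\<bar> < norm q"
  shows "emeasure lborel {\<theta>\<in>{0..<2*pi}. level_point q e1 e2 t \<theta> \<in> N} = ennreal (circle_aperture N q e1 e2 t)"
proof -
  have "(\<lambda>\<theta>. level_point q e1 e2 t \<theta>) \<in> borel_measurable borel"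
    unfolding level_point_def by (intro borel_measurable_continuous_onI continuous_intros)
  from measurable_sets[OF this N] have m: "{\<theta>\<in>{0..<2*pi}. level_point q e1 e2 t \<theta> \<in> N} \<in> sets borel"
    by (auto simp: Collect_conj_eq vimage_def)
  have "bounded {\<theta>\<in>{0..<2*pi}. level_point q e1 e2 t \<theta> \<in> N}"
    by (rule bounded_subset[of "{0..<2*pi}"]) auto
  then have "emeasure lborel {\<theta>\<in>{0..<2*pi}. level_point q e1 e2 t \<theta> \<in> N} \<noteq> top"
    using emeasure_bounded_finite by fastforce
  then show ?thesis using assms m by (simp add: circle_aperture_def emeasure_eq_ennreal_measure)
qed

lemma circle_aperture_measurable: "circle_aperture N q e1 e2 \<in> borel_measurable borel"
proof -
  define S where "S = {(t, \<theta>). \<bar>t\<bar> < norm q \<and> \<theta> \<in> {0..<2*pi} \<and> level_point q e1 e2 t \<theta> \<in> N}"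
  have "S = ({- norm q<..<norm q} \<times> {0..<2*pi}) \<inter> (\<lambda>(t, \<theta>). level_point q e1 e2 t \<theta>) -` N"
    by (auto simp: S_def)
  moreover have "{- norm q<..<norm q} \<times> {0..<2*pi} \<in> sets (borel :: (real \<times> real) measure)"
    unfolding borel_prod[symmetric] by (intro pair_measureI) auto
  ultimately have "S \<in> sets (borel \<Otimes>\<^sub>M lborel)"
    using measurable_sets[OF level_point_measurable N] unfolding sets_pair_borel by auto
  from lborel.measurable_emeasure_Pair[OF this]
  have "(\<lambda>t. enn2real (emeasure lborel (Pair t -` S))) \<in> borel_measurable borel" by simp
  moreover have "enn2real (emeasure lborel (Pair t -` S)) = circle_aperture N q e1 e2 t" for t
  proof (cases "\<bar>t\<bar> < norm q")
    case True
    then have "Pair t -` S = {\<theta>\<in>{0..<2*pi}. level_point q e1 e2 t \<theta> \<in> N}" by (auto simp: S_def)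
    then show ?thesis using emeasure_circle_aperture[OF True] by (simp add: circle_aperture_nonneg)
  next
    case False
    then have "Pair t -` S = {}" by (auto simp: S_def)
    with False show ?thesis by (simp add: circle_aperture_def)
  qed
  ultimately show ?thesis by simp
qed

text \<open>Taking \<open>q /\<^sub>R norm q\<close> as third axis, the height on the sphere is
  \<open>z\<close> and \<open>q \<bullet> u = norm q * z\<close>. Tonelli integrates out the angle,
  which leaves the aperture.\<close>

lemma emeasure_uniform_sphere_level:
  assumes A: "A \<in> sets borel"
  shows "emeasure uniform_sphere {u\<in>N. q \<bullet> u \<in> A}
      = (\<integral>\<^sup>+t. ennreal (1 / (4 * pi) * (circle_aperture N q e1 e2 t / norm q)) * indicator A t \<partial>lborel)"
proof -
  interpret orthonormal_triple e1 e2 "q /\<^sub>R norm q"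
    using orthonormal_frame_inner[OF frame] q by unfold_locales (simp_all add: dot_square_norm power2_eq_square)
  have \<psi>_level: "\<psi> (z, \<theta>) = level_point q e1 e2 (norm q * z) \<theta>" for z \<theta>
    using q by (simp add: \<psi>_def level_point_def power_mult_distrib power2_eq_square divide_inverse mult_ac)
  have \<psi>_inner: "q \<bullet> \<psi> (z, \<theta>) = norm q * z" for z \<theta>
    using orthonormal_frame_inner[OF frame] q by (simp add: \<psi>_def inner_add inner_commute dot_square_norm power2_eq_square)
  have "(\<lambda>u. q \<bullet> u) \<in> borel_measurable borel" by measurable
  from measurable_sets[OF this A] N have X: "{u\<in>N. q \<bullet> u \<in> A} \<in> sets borel"
    by (auto simp: Collect_conj_eq vimage_def)
  let ?F = "\<lambda>t. ennreal (circle_aperture N q e1 e2 t) * indicator A t"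
  have Fm: "?F \<in> borel_measurable borel" using A circle_aperture_measurable by measurable
  have S: "{p\<in>R. \<psi> p \<in> {u\<in>N. q \<bullet> u \<in> A}} \<in> sets (lborel \<Otimes>\<^sub>M lborel)"
    using measurable_sets[OF measurable_\<psi> X] R_borel
    unfolding sets_pair_borel by (auto simp: Collect_conj_eq vimage_def)
  have "emeasure lborel {p\<in>R. \<psi> p \<in> {u\<in>N. q \<bullet> u \<in> A}}
     = (\<integral>\<^sup>+z. emeasure lborel (Pair z -` {p\<in>R. \<psi> p \<in> {u\<in>N. q \<bullet> u \<in> A}}) \<partial>lborel)"
    using lborel.emeasure_pair_measure_alt[OF S] by (simp add: lborel_prod)
  also have "\<dots> = (\<integral>\<^sup>+z. ?F (0 + norm q * z) \<partial>lborel)"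
  proof (intro nn_integral_cong)
    fix z :: real
    have abs: "\<bar>norm q * z\<bar> < norm q \<longleftrightarrow> \<bar>z\<bar> < 1" using q by (simp add: abs_mult)
    have "Pair z -` {p\<in>R. \<psi> p \<in> {u\<in>N. q \<bullet> u \<in> A}} =
      (if \<bar>z\<bar> < 1 \<and> norm q * z \<in> A then {\<theta>\<in>{0..<2*pi}. level_point q e1 e2 (norm q * z) \<theta> \<in> N} else {})"
      by (auto simp: R_def \<psi>_inner) (auto simp: \<psi>_level)
    then show "emeasure lborel (Pair z -` {p\<in>R. \<psi> p \<in> {u\<in>N. q \<bullet> u \<in> A}}) = ?F (0 + norm q * z)"
      using emeasure_circle_aperture[of "norm q * z"] abs by (auto simp: circle_aperture_def indicator_def)
  qed
  \<comment> \<open>The substitution \<open>t = norm q * z\<close> produces the divisor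
    \<open>norm q\<close> of the density.\<close>
  also have "\<dots> = ennreal (1 / norm q) * (\<integral>\<^sup>+t. ?F t \<partial>lborel)"
    using nn_integral_real_affine[OF Fm, of "norm q" 0] q
    by (simp add: mult.assoc[symmetric] ennreal_mult[symmetric])
  finally have "emeasure uniform_sphere {u\<in>N. q \<bullet> u \<in> A}
      = ennreal (1 / (4 * pi)) * (ennreal (1 / norm q) * (\<integral>\<^sup>+t. ?F t \<partial>lborel))"
    using emeasure_uniform_sphere[OF X] by simp
  also have "\<dots> = (\<integral>\<^sup>+t. ennreal (1 / (4 * pi)) * (ennreal (1 / norm q) * ?F t) \<partial>lborel)"
    using Fm by (simp add: nn_integral_cmult)
  also have "\<dots> = (\<integral>\<^sup>+t. ennreal (1 / (4 * pi) * (circle_aperture N q e1 e2 t / norm q)) * indicator A t \<partial>lborel)"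
    by (intro nn_integral_cong) (simp add: indicator_def circle_aperture_nonneg flip: ennreal_mult)
  finally show ?thesis .
qed

end

subsection \<open>Normal cones at the vertices of a polytope\<close>

text \<open>The difference body is the image of \<open>P \<times> P\<close> under a linear map, and
  such maps commute with convex hulls.\<close>

lemma polytope_differences:
  fixes P :: "'a::euclidean_space set"
  assumes "polytope P"
  shows "polytope {x - y | x y. x \<in> P \<and> y \<in> P}"
proof -
  obtain V where V: "finite V" "P = convex hull V" using assms by (auto simp: polytope_def)
  have lin: "linear (\<lambda>p::'a \<times> 'a. fst p - snd p)"
    by (intro linear_compose_sub linear_fst linear_snd)
  have "{x - y | x y. x \<in> P \<and> y \<in> P} = (\<lambda>p. fst p - snd p) ` (P \<times> P)" by force
  also have "\<dots> = convex hull ((\<lambda>p. fst p - snd p) ` (V \<times> V))"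
    unfolding V(2) by (simp only: convex_hull_Times[symmetric] convex_hull_linear_image[OF lin])
  finally show ?thesis unfolding polytope_def using V(1)
    by (intro exI[of _ "(\<lambda>p. fst p - snd p) ` (V \<times> V)"] conjI finite_imageI finite_cartesian_product)
qed

text \<open>Both \<open>u\<close> and \<open>y\<close> are parallel to the cross product of
  \<open>b\<close> and \<open>b'\<close>, which is nonzero because \<open>b\<close> and
  \<open>b'\<close> are independent.\<close>

lemma parallel_of_orthogonal_pair:
  fixes b b' u y :: "real^3"
  assumes nonpar: "\<And>c. b' \<noteq> c *\<^sub>R b" and b: "b \<noteq> 0" and u: "u \<noteq> 0" "b \<bullet> u = 0" "b' \<bullet> u = 0"
    and y: "b \<bullet> y = 0" "b' \<bullet> y = 0"
  obtains c where "y = c *\<^sub>R u"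
proof -
  define w where "w = cross3 b b'"
  have w: "w \<noteq> 0"
  proof
    assume "w = 0"
    then have "collinear {0, b, b'}" by (simp add: w_def cross_eq_0)
    then show False using nonpar b unfolding collinear_lemma by (metis scaleR_zero_left)
  qed
  have lagrange: "cross3 v w = (v \<bullet> b') *\<^sub>R b - (v \<bullet> b) *\<^sub>R b'" for v
    unfolding w_def by (rule Lagrange)
  have "cross3 u w = 0" "cross3 y w = 0"
    using u y by (simp_all add: lagrange inner_commute)
  then have "collinear {0, u, w}" "collinear {0, y, w}" by (simp_all add: cross_eq_0)
  then obtain c d where "w = c *\<^sub>R u" "y = 0 \<or> w = d *\<^sub>R y"
    using u(1) w unfolding collinear_lemma by blast
  then show ?thesis
  proof (elim disjE)
    assume "y = 0" then show ?thesis using that[of 0] by simp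
  next
    assume *: "w = c *\<^sub>R u" "w = d *\<^sub>R y"
    then have "d \<noteq> 0" using w by auto
    then have "y = (1 / d) *\<^sub>R (d *\<^sub>R y)" by simp
    also have "\<dots> = (c / d) *\<^sub>R u" using * by (metis divide_inverse mult.commute mult_1 scaleR_scaleR)
    finally have "y = (c / d) *\<^sub>R u" .
    then show ?thesis by (rule that)
  qed
qed

text \<open>Inward normals of half-spaces whose intersection is the normal cone. Different elements
  may be parallel, and an element need not define a facet.\<close>

definition vertex_differences :: "(real^3) set \<Rightarrow> real^3 \<Rightarrow> (real^3) set" where
  "vertex_differences Q q = (\<lambda>x. q - x) ` (vert Q - {q})"

text \<open>The interior of the normal cone: the directions in which \<open>q\<close> beats every
  other vertex strictly.\<close>

definition open_normal_cone :: "(real^3) set \<Rightarrow> real^3 \<Rightarrow> (real^3) set" where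
  "open_normal_cone Q q = {y. \<forall>b\<in>vertex_differences Q q. b \<bullet> y > 0}"

text \<open>The full dimension of the original polytope is recorded as a ball of radius
  \<open>r\<close> about the origin in its difference body.\<close>

locale polytope_vertex =
  fixes Q :: "(real^3) set" and q :: "real^3" and r :: real
  assumes polytope: "polytope Q" and r: "r > 0" "cball 0 r \<subseteq> Q" and q: "q \<in> vert Q"
begin

abbreviation "N \<equiv> normal_cone Q q"
abbreviation "N\<^sub>o \<equiv> open_normal_cone Q q"
abbreviation "W \<equiv> vertex_differences Q q"

lemma finite_vert: "finite (vert Q)"
  unfolding vert_def using finite_polyhedron_extreme_points polytope polytope_imp_polyhedron by blast

lemma finite_W: "finite W" using finite_vert by (simp add: vertex_differences_def)

lemma zero_notin_W: "0 \<notin> W" by (auto simp: vertex_differences_def)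

lemma Q_eq_hull: "Q = convex hull (vert Q)"
  unfolding vert_def by (rule Krein_Milman_Minkowski) (use polytope polytope_imp_compact polytope_imp_convex in auto)

lemma normal_cone_eq: "N = {y. \<forall>b\<in>W. b \<bullet> y \<ge> 0}"
proof (intro set_eqI iffI)
  fix y assume y: "y \<in> N"
  have "vert Q \<subseteq> Q" using Q_eq_hull hull_subset by metis
  then show "y \<in> {y. \<forall>b\<in>W. b \<bullet> y \<ge> 0}"
    using y by (auto simp: normal_cone_def vertex_differences_def inner_diff inner_commute)
next
  fix y assume y: "y \<in> {y. \<forall>b\<in>W. b \<bullet> y \<ge> 0}"
  have "vert Q \<subseteq> {x. y \<bullet> x \<le> y \<bullet> q}"
  proof
    fix x assume "x \<in> vert Q"
    then show "x \<in> {x. y \<bullet> x \<le> y \<bullet> q}"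
      using y by (cases "x = q") (auto simp: vertex_differences_def inner_diff inner_commute)
  qed
  then have "convex hull (vert Q) \<subseteq> {x. y \<bullet> x \<le> y \<bullet> q}"
    by (rule hull_minimal) (rule convex_halfspace_le)
  then show "y \<in> N" using Q_eq_hull by (auto simp: normal_cone_def)
qed

lemma N\<^sub>o_subset: "N\<^sub>o \<subseteq> N"
  unfolding normal_cone_eq open_normal_cone_def by (auto intro: less_imp_le)

lemma open_N\<^sub>o: "open N\<^sub>o"
proof -
  have "N\<^sub>o = (\<Inter>b\<in>W. {y. b \<bullet> y > 0})" by (auto simp: open_normal_cone_def)
  then show ?thesis using finite_W by (auto intro!: open_INT open_halfspace_gt)
qed

lemma polyhedron_N: "polyhedron N"
proof -
  have "N = \<Inter>((\<lambda>b. {y. b \<bullet> y \<ge> 0}) ` W)" by (auto simp: normal_cone_eq)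
  then show ?thesis using finite_W
    by (auto intro!: polyhedron_Inter polyhedron_halfspace_ge)
qed

lemma convex_N: "convex N" by (rule polyhedron_imp_convex[OF polyhedron_N])

lemma closed_N: "closed N" by (rule polyhedron_imp_closed[OF polyhedron_N])

text \<open>Test the maximality of \<open>q\<close> in direction \<open>y\<close> against the point
  of the ball in that direction. The bound makes the cone pointed and excludes heights below
  \<open>r\<close> from the cell.\<close>

lemma q_pos:
  assumes y: "y \<in> N"
  shows "q \<bullet> y \<ge> r * norm y"
proof (cases "y = 0")
  case False
  have "(r / norm y) *\<^sub>R y \<in> Q" using r False by (auto intro!: subsetD[OF r(2)])
  then have "y \<bullet> ((r / norm y) *\<^sub>R y) \<le> y \<bullet> q" using y by (auto simp: normal_cone_def)
  then show ?thesis using False by (simp add: dot_square_norm power2_eq_square inner_commute)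
qed auto

text \<open>A vertex of a polytope is exposed, and the functional \<open>a\<close> exposing it beats
  all other vertices strictly.\<close>

lemma N\<^sub>o_nonempty: "N\<^sub>o \<noteq> {}"
proof -
  have "{q} face_of Q" using q by (simp add: vert_def face_of_singleton)
  then have "{q} exposed_face_of Q"
    using exposed_face_of_polyhedron polytope polytope_imp_polyhedron by blast
  then obtain a c where ac: "Q \<subseteq> {x. a \<bullet> x \<le> c}" "{q} = Q \<inter> {x. a \<bullet> x = c}"
    by (auto simp: exposed_face_of_def)
  have "vert Q \<subseteq> Q" using Q_eq_hull hull_subset by metis
  have "a \<in> N\<^sub>o" unfolding open_normal_cone_def vertex_differences_def
  proof (intro CollectI ballI, elim imageE)
    fix b x assume bx: "b = q - x" "x \<in> vert Q - {q}"
    then have x: "x \<in> vert Q" "x \<noteq> q" by auto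
    then have "x \<in> Q" "a \<bullet> x \<noteq> c" using ac(2) \<open>vert Q \<subseteq> Q\<close> by auto
    then have "a \<bullet> x < c" using ac(1) by force
    moreover have "a \<bullet> q = c" using ac(2) by auto
    ultimately show "0 < b \<bullet> a" by (simp add: bx inner_diff inner_commute)
  qed
  then show ?thesis by auto
qed

text \<open>If \<open>q\<close> were 0, the bound \<open>q_pos\<close> would leave only the zero
  vector in the cone, which contains a nonempty open set.\<close>

lemma q_nonzero: "q \<noteq> 0"
proof
  assume "q = 0"
  have "\<exists>y\<in>N\<^sub>o. y \<noteq> 0"
  proof (rule ccontr)
    assume "\<not> ?thesis"
    then have "N\<^sub>o = {0}" using N\<^sub>o_nonempty by auto
    then show False using open_N\<^sub>o not_open_singleton by metis
  qed
  then obtain y where y: "y \<in> N\<^sub>o" "y \<noteq> 0" by auto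
  then have "r * norm y \<le> 0" using q_pos[of y] N\<^sub>o_subset \<open>q = 0\<close> by auto
  then show False using y r by (simp add: mult_le_0_iff)
qed

lemma aff_dim_N: "aff_dim N = 3"
proof -
  have "aff_dim N\<^sub>o = 3" using aff_dim_open[OF open_N\<^sub>o N\<^sub>o_nonempty] by simp
  then show ?thesis using aff_dim_subset[OF N\<^sub>o_subset] aff_dim_le_DIM[of N] by simp
qed

lemma interior_of_normal_cell:
  "top_of_set (sphere 0 1) interior_of normal_cell Q q = N\<^sub>o \<inter> sphere 0 1"
proof (intro equalityI subsetI)
  fix u assume "u \<in> N\<^sub>o \<inter> sphere 0 1"
  moreover have "openin (top_of_set (sphere 0 1)) (N\<^sub>o \<inter> sphere 0 1)"
    using open_N\<^sub>o by (metis inf_commute openin_open_Int)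
  moreover have "N\<^sub>o \<inter> sphere 0 1 \<subseteq> normal_cell Q q"
    using N\<^sub>o_subset by (auto simp: normal_cell_def)
  ultimately show "u \<in> top_of_set (sphere 0 1) interior_of normal_cell Q q"
    using interior_of_maximal by blast
next
  fix u assume "u \<in> top_of_set (sphere 0 1) interior_of normal_cell Q q"
  then obtain T where "openin (top_of_set (sphere 0 1)) T" and T: "u \<in> T" "T \<subseteq> normal_cell Q q"
    by (auto simp: interior_of_def)
  then obtain O' where O': "open O'" "T = sphere 0 1 \<inter> O'" by (auto simp: openin_open)
  have u: "u \<in> N" "norm u = 1" "u \<in> O'" using T O' by (auto simp: normal_cell_def)
  have "b \<bullet> u > 0" if b: "b \<in> W" for b
  proof (rule ccontr)
    assume "\<not> b \<bullet> u > 0"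
    then have bu: "b \<bullet> u = 0" using u(1) b by (auto simp: normal_cone_eq)
    have b0: "b \<noteq> 0" using b zero_notin_W by auto
    \<comment> \<open>Push \<open>u\<close> against the active normal \<open>b\<close> and return to
      the sphere. The path tends to \<open>u\<close>, yet every point with \<open>e > 0\<close>
      violates the constraint \<open>b\<close>, so \<open>u\<close> is not interior.\<close>
    define p where "p e = (u - e *\<^sub>R b) /\<^sub>R norm (u - e *\<^sub>R b)" for e :: real
    have "(p \<longlongrightarrow> p 0) (at_right 0)"
      unfolding p_def by (intro tendsto_intros) (use u in auto)
    moreover have "p 0 = u" using u by (simp add: p_def)
    ultimately have "\<forall>\<^sub>F e in at_right 0. p e \<in> O'"
      using O' u by (auto intro: topological_tendstoD)
    moreover have "\<forall>\<^sub>F e in at_right 0. (0::real) < e" by (simp add: eventually_at_right_less)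
    ultimately have "\<forall>\<^sub>F e in at_right 0. p e \<in> O' \<and> 0 < e" by (rule eventually_conj)
    from eventually_happens'[OF _ this] obtain e where e: "p e \<in> O'" "e > 0" by auto
    have neg: "b \<bullet> (u - e *\<^sub>R b) < 0" using bu b0 e by (simp add: inner_diff)
    then have "u - e *\<^sub>R b \<noteq> 0" by auto
    then have "norm (p e) = 1" "b \<bullet> p e < 0"
      using neg by (auto simp: p_def mult_less_0_iff)
    then have "p e \<in> T" "p e \<notin> N" using O' e b by (auto simp: normal_cone_eq not_le intro!: bexI[of _ b])
    then show False using T by (auto simp: normal_cell_def)
  qed
  then show "u \<in> N\<^sub>o \<inter> sphere 0 1" using u by (simp add: open_normal_cone_def)
qed

text \<open>Two independent active normals cut out a line, of which the pointed cone keeps one half.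
  This is how a spherical vertex is recognised.\<close>

lemma ray_face:
  assumes u: "u \<in> N" "u \<noteq> 0" and b: "b \<in> W" "b' \<in> W" "b \<bullet> u = 0" "b' \<bullet> u = 0"
    and nonpar: "\<And>c. b' \<noteq> c *\<^sub>R b"
  shows "(conic hull {u}) face_of N"
proof -
  \<comment> \<open>On the cone both products are nonnegative, so their sum vanishes exactly where
    both do; one supporting plane thus encodes both constraints.\<close>
  have "N \<inter> {y. (b + b') \<bullet> y = 0} face_of N"
    by (rule face_of_Int_supporting_hyperplane_ge[OF convex_N]) (use b in \<open>auto simp: normal_cone_eq inner_add\<close>)
  moreover have "N \<inter> {y. (b + b') \<bullet> y = 0} = conic hull {u}"
  proof (intro equalityI subsetI)
    fix y assume y: "y \<in> N \<inter> {y. (b + b') \<bullet> y = 0}"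
    then have "b \<bullet> y \<ge> 0" "b' \<bullet> y \<ge> 0" "b \<bullet> y + b' \<bullet> y = 0" using b by (auto simp: normal_cone_eq inner_add)
    then have "b \<bullet> y = 0" "b' \<bullet> y = 0" by linarith+
    moreover have "b \<noteq> 0" using b zero_notin_W by auto
    ultimately obtain c where c: "y = c *\<^sub>R u"
      using parallel_of_orthogonal_pair[OF nonpar _ u(2) b(3,4)] by metis
    have "c \<ge> 0"
    proof (rule ccontr)
      assume "\<not> c \<ge> 0"
      have "q \<bullet> y \<ge> r * norm y" using y q_pos by auto
      moreover have "r * norm y \<ge> 0" using r by simp
      moreover have "q \<bullet> u > 0" using q_pos[OF u(1)] u(2) r by (smt (verit) mult_pos_pos zero_less_norm_iff)
      then have "q \<bullet> y < 0" using \<open>\<not> c \<ge> 0\<close> by (simp add: c mult_less_0_iff)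
      ultimately show False by linarith
    qed
    then show "y \<in> conic hull {u}" using c by (auto simp: conic_hull_explicit)
  next
    fix y assume "y \<in> conic hull {u}"
    then obtain c where "y = c *\<^sub>R u" "c \<ge> 0" by (auto simp: conic_hull_explicit)
    then show "y \<in> N \<inter> {y. (b + b') \<bullet> y = 0}" using u b by (auto simp: normal_cone_eq inner_add)
  qed
  ultimately show ?thesis by simp
qed

text \<open>The inactive constraints stay strict near \<open>u\<close>, and the active ones all say
  the same thing, so the cone is locally a half-space. Its boundary plane is locally contained in
  the cone, which makes the face two-dimensional.\<close>

lemma facet_point:
  assumes u: "u \<in> N" and b: "b \<in> W" "b \<bullet> u = 0"
    and par: "\<And>b'. b' \<in> W \<Longrightarrow> b' \<bullet> u = 0 \<Longrightarrow> \<exists>c. b' = c *\<^sub>R b"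
  obtains \<epsilon> where "\<epsilon> > 0" "\<And>y. y \<in> ball u \<epsilon> \<Longrightarrow> y \<in> N\<^sub>o \<longleftrightarrow> b \<bullet> y > 0" "supports_arc Q q b"
proof -
  obtain y0 where y0: "y0 \<in> N\<^sub>o" using N\<^sub>o_nonempty by auto
  \<comment> \<open>A nonpositive multiple is impossible: both normals are positive at the interior
    point \<open>y0\<close>.\<close>
  have pos: "\<exists>c>0. b' = c *\<^sub>R b" if b': "b' \<in> W" "b' \<bullet> u = 0" for b'
  proof -
    obtain c where c: "b' = c *\<^sub>R b" using par[OF b'] by blast
    have "b \<bullet> y0 > 0" "b' \<bullet> y0 > 0" using y0 b b' by (auto simp: open_normal_cone_def)
    then have "c > 0" by (simp add: c zero_less_mult_iff)
    with c show ?thesis by blast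
  qed
  define G where "G = (\<Inter>b'\<in>{b'\<in>W. b' \<bullet> u \<noteq> 0}. {y. b' \<bullet> y > 0})"
  have "open G" unfolding G_def using finite_W by (intro open_INT) (auto intro: open_halfspace_gt)
  moreover have "u \<in> G" unfolding G_def using u by (auto simp: normal_cone_eq less_le)
  ultimately obtain \<epsilon> where \<epsilon>: "\<epsilon> > 0" "ball u \<epsilon> \<subseteq> G" by (meson open_contains_ball)
  have No: "y \<in> N\<^sub>o \<longleftrightarrow> b \<bullet> y > 0" if y: "y \<in> ball u \<epsilon>" for y
  proof
    assume bpos: "b \<bullet> y > 0"
    have "b' \<bullet> y > 0" if "b' \<in> W" for b'
    proof (cases "b' \<bullet> u = 0")
      case True
      then show ?thesis using pos[OF that] bpos by auto
    next
      case False
      then show ?thesis using that y \<epsilon>(2) by (auto simp: G_def)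
    qed
    then show "y \<in> N\<^sub>o" by (simp add: open_normal_cone_def)
  qed (use b in \<open>auto simp: open_normal_cone_def\<close>)
  have Nc: "y \<in> N" if y: "y \<in> ball u \<epsilon>" "b \<bullet> y = 0" for y
  proof -
    have "b' \<bullet> y \<ge> 0" if "b' \<in> W" for b'
    proof (cases "b' \<bullet> u = 0")
      case True
      then show ?thesis using pos[OF that] y by auto
    next
      case False
      then have "b' \<bullet> y > 0" using that y \<epsilon>(2) by (auto simp: G_def)
      then show ?thesis by simp
    qed
    then show ?thesis by (simp add: normal_cone_eq)
  qed
  have b0: "b \<noteq> 0" using b zero_notin_W by auto
  let ?F = "N \<inter> {y. b \<bullet> y = 0}"
  have "?F face_of N"
    by (rule face_of_Int_supporting_hyperplane_ge[OF convex_N]) (use b in \<open>auto simp: normal_cone_eq\<close>)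
  moreover have "?F \<noteq> {}" using u b by auto
  moreover have "aff_dim ?F = 2"
  proof -
    have "aff_dim ({y. b \<bullet> y = 0} \<inter> ball u \<epsilon>) = aff_dim {y. b \<bullet> y = 0}"
      by (rule aff_dim_convex_Int_open) (use \<epsilon> b in \<open>auto intro: convex_hyperplane\<close>)
    also have "\<dots> = 2" using b0 by (simp add: aff_dim_hyperplane)
    finally have "aff_dim ({y. b \<bullet> y = 0} \<inter> ball u \<epsilon>) = 2" .
    moreover have "{y. b \<bullet> y = 0} \<inter> ball u \<epsilon> \<subseteq> ?F" using Nc by blast
    ultimately have "2 \<le> aff_dim ?F" using aff_dim_subset by metis
    moreover have "aff_dim ?F \<le> aff_dim {y. b \<bullet> y = 0}" by (intro aff_dim_subset) auto
    ultimately show ?thesis using b0 by (simp add: aff_dim_hyperplane)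
  qed
  ultimately have "supports_arc Q q b" using b0 by (simp add: supports_arc_def facet_of_def aff_dim_N)
  then show ?thesis using that \<epsilon>(1) No by blast
qed

section \<open>Finiteness of the candidate values\<close>

text \<open>A facet spans its plane as an affine hull, so equal facets have equal planes, and a
  plane determines its normal up to a factor.\<close>

lemma supports_arc_unique:
  assumes "supports_arc Q q b" "supports_arc Q q b'" "N \<inter> {y. b \<bullet> y = 0} = N \<inter> {y. b' \<bullet> y = 0}"
  obtains c where "b' = c *\<^sub>R b" "c \<noteq> 0"
proof -
  have hull: "affine hull (N \<inter> {y. a \<bullet> y = 0}) = {y. a \<bullet> y = 0}" if "supports_arc Q q a" for a
  proof (rule affine_dim_equal)
    have a: "a \<noteq> 0" "aff_dim (N \<inter> {y. a \<bullet> y = 0}) = 2" "N \<inter> {y. a \<bullet> y = 0} \<noteq> {}"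
      using that by (auto simp: supports_arc_def facet_of_def aff_dim_N)
    then show "affine hull (N \<inter> {y. a \<bullet> y = 0}) \<noteq> {}" by simp
    show "aff_dim (affine hull (N \<inter> {y. a \<bullet> y = 0})) = aff_dim {y. a \<bullet> y = 0}"
      using a by (simp add: aff_dim_affine_hull aff_dim_hyperplane)
    show "affine hull (N \<inter> {y. a \<bullet> y = 0}) \<subseteq> {y. a \<bullet> y = 0}"
      by (rule hull_minimal) (auto intro: affine_hyperplane)
  qed (auto intro: affine_hyperplane affine_affine_hull)
  have H: "{y. b \<bullet> y = 0} = {y. b' \<bullet> y = 0}" using hull[OF assms(1)] hull[OF assms(2)] unfolding assms(3) by metis
  have b: "b \<noteq> 0" "b' \<noteq> 0" using assms by (auto simp: supports_arc_def)
  \<comment> \<open>The component of \<open>b'\<close> orthogonal to \<open>b\<close>; it lies in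
    both planes and is therefore orthogonal to itself.\<close>
  define y where "y = b' - ((b \<bullet> b') / (b \<bullet> b)) *\<^sub>R b"
  have "b \<bullet> y = 0" using b by (simp add: y_def inner_diff)
  moreover from this have "b' \<bullet> y = 0" using H by blast
  ultimately have "y \<bullet> y = 0" by (subst (1) y_def) (simp add: inner_diff)
  then have "b' = ((b \<bullet> b') / (b \<bullet> b)) *\<^sub>R b" by (simp add: y_def)
  moreover from this b(2) have "(b \<bullet> b') / (b \<bullet> b) \<noteq> 0" by (metis scaleR_zero_left)
  ultimately show ?thesis by (rule that)
qed

lemma arc_tangency_values_scale:
  assumes "c \<noteq> 0"
  shows "arc_tangency_values q (c *\<^sub>R b) = arc_tangency_values q b"
proof -
  have "(c *\<^sub>R b) /\<^sub>R norm (c *\<^sub>R b) = (c / \<bar>c\<bar>) *\<^sub>R (b /\<^sub>R norm b)"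
    by (simp add: divide_inverse mult_ac)
  moreover have "(q \<bullet> (s *\<^sub>R v)) *\<^sub>R (s *\<^sub>R v) = (s * s) *\<^sub>R ((q \<bullet> v) *\<^sub>R v)" for v s
    by (simp add: mult_ac)
  moreover have "c / \<bar>c\<bar> * (c / \<bar>c\<bar>) = 1" using assms by simp
  ultimately show ?thesis unfolding arc_tangency_values_def Let_def by (simp only: scaleR_one)
qed

text \<open>Infinitely many \<open>b\<close> support the same arc, but the tangency values are
  unchanged by scaling \<open>b\<close>. They are thus a function of the facet, and the cone has
  finitely many facets.\<close>

lemma finite_tangency_values: "finite (tangency_values Q q)"
proof -
  let ?F = "\<lambda>b. N \<inter> {y. b \<bullet> y = 0}"
  define val where "val F = arc_tangency_values q (SOME b. supports_arc Q q b \<and> ?F b = F)" for F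
  have "tangency_values Q q \<subseteq> (\<Union>F\<in>{F. F facet_of N}. val F)"
  proof
    fix t assume "t \<in> tangency_values Q q"
    then obtain b where b: "supports_arc Q q b" "t \<in> arc_tangency_values q b"
      by (auto simp: tangency_values_def)
    define b' where "b' = (SOME b'. supports_arc Q q b' \<and> ?F b' = ?F b)"
    have b': "supports_arc Q q b' \<and> ?F b' = ?F b" unfolding b'_def
      by (rule someI[of _ b]) (use b in simp)
    then obtain c where "b' = c *\<^sub>R b" "c \<noteq> 0" using supports_arc_unique[OF b(1), of b'] by metis
    then have "t \<in> val (?F b)" unfolding val_def b'_def[symmetric] using b by (simp add: arc_tangency_values_scale)
    moreover have "?F b facet_of N" using b by (simp add: supports_arc_def)
    ultimately show "t \<in> (\<Union>F\<in>{F. F facet_of N}. val F)" by blast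
  qed
  moreover have "finite (\<Union>F\<in>{F. F facet_of N}. val F)"
    by (intro finite_UN_I finite_polyhedron_facets polyhedron_N) (simp add: val_def arc_tangency_values_def Let_def)
  ultimately show ?thesis by (rule finite_subset)
qed

text \<open>A unit vector is determined by its ray, and the cone has finitely many faces.\<close>

lemma finite_vertex_values: "finite (vertex_values Q q)"
proof -
  have "inj_on (\<lambda>v. conic hull {v}) {v. spherical_vertex Q q v}"
  proof (rule inj_onI, clarsimp simp: spherical_vertex_def)
    fix v w :: "real^3" assume *: "conic hull {v} = conic hull {w}" "norm v = 1" "norm w = 1"
    have "v \<in> conic hull {w}" using *(1) hull_inc by (metis singletonI)
    then obtain c where "v = c *\<^sub>R w" "c \<ge> 0" by (auto simp: conic_hull_explicit)
    then show "v = w" using * by simp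
  qed
  moreover have "(\<lambda>v. conic hull {v}) ` {v. spherical_vertex Q q v} \<subseteq> {F. F face_of N}"
    by (auto simp: spherical_vertex_def)
  ultimately have "finite {v. spherical_vertex Q q v}"
    using finite_polyhedron_faces[OF polyhedron_N] by (meson finite_imageD finite_subset)
  then show ?thesis by (simp add: vertex_values_def setcompr_eq_image)
qed

lemma finite_candidate_values: "finite (candidate_values Q q)"
  by (simp add: candidate_values_def finite_tangency_values finite_vertex_values axial_values_def)

lemma critical_subset_candidate: "critical_values Q q \<subseteq> candidate_values Q q"
  by (auto simp: critical_values_def candidate_values_def met_tangency_values_def tangency_values_def)

end

subsection \<open>Analyticity of the aperture\<close>

lemma real_analytic_at_zero_near:
  assumes "open A" "x \<in> A" "\<And>y. y \<in> A \<Longrightarrow> f y = 0"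
  shows "real_analytic_at f x"
  by (rule real_analytic_at_cong[OF real_analytic_at_const[of 0]])
    (rule eventually_mono[OF eventually_nhds_in_open[OF assms(1,2)]], simp add: assms(3))

lemma continuous_level_point:
  assumes "q \<noteq> 0"
  shows "continuous_on UNIV (\<lambda>p. level_point q e1 e2 (fst p) (snd p))"
  unfolding level_point_def by (intro continuous_intros) (use assms in auto)

lemma level_point_preimage:
  assumes "q \<noteq> 0" "open G" "level_point q e1 e2 t0 \<theta>0 \<in> G"
  obtains T V where "open T" "open V" "t0 \<in> T" "\<theta>0 \<in> V"
    "\<And>t \<theta>. t \<in> T \<Longrightarrow> \<theta> \<in> V \<Longrightarrow> level_point q e1 e2 t \<theta> \<in> G"
proof -
  have "open ((\<lambda>p. level_point q e1 e2 (fst p) (snd p)) -` G)"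
    by (rule open_vimage[OF assms(2) continuous_level_point[OF assms(1)]])
  moreover have "(t0, \<theta>0) \<in> (\<lambda>p. level_point q e1 e2 (fst p) (snd p)) -` G" using assms(3) by simp
  ultimately obtain T V where "open T" "open V" "(t0, \<theta>0) \<in> T \<times> V"
    "T \<times> V \<subseteq> (\<lambda>p. level_point q e1 e2 (fst p) (snd p)) -` G" by (rule open_prod_elim)
  then show ?thesis by (intro that[of T V]) auto
qed

text \<open>By the sum-to-product formula the difference of the cosines is a product of two sines:
  one is nonzero near \<open>\<theta>0\<close> by transversality, the other because the angles
  differ by less than \<open>pi\<close>.\<close>

lemma cos_ne_near:
  fixes \<theta>0 \<phi> :: real
  assumes "sin (\<theta>0 - \<phi>) \<noteq> 0"
  obtains \<delta> where "\<delta> > 0" "\<And>\<theta>. \<theta> \<noteq> \<theta>0 \<Longrightarrow> \<bar>\<theta> - \<theta>0\<bar> < \<delta> \<Longrightarrow> cos (\<theta> - \<phi>) \<noteq> cos (\<theta>0 - \<phi>)"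
proof -
  have "open {\<theta>. sin ((\<theta> + \<theta>0) / 2 - \<phi>) \<noteq> 0}" by (intro open_Collect_neq continuous_intros) auto
  moreover have "\<theta>0 \<in> {\<theta>. sin ((\<theta> + \<theta>0) / 2 - \<phi>) \<noteq> 0}" using assms by simp
  ultimately obtain d where d: "d > 0" "ball \<theta>0 d \<subseteq> {\<theta>. sin ((\<theta> + \<theta>0) / 2 - \<phi>) \<noteq> 0}"
    by (meson open_contains_ball)
  show ?thesis
  proof (rule that[of "min d pi"])
    show "min d pi > 0" using d by simp
    fix \<theta> assume \<theta>: "\<theta> \<noteq> \<theta>0" "\<bar>\<theta> - \<theta>0\<bar> < min d pi"
    have "cos (\<theta> - \<phi>) - cos (\<theta>0 - \<phi>) = 2 * sin ((\<theta> + \<theta>0) / 2 - \<phi>) * sin ((\<theta>0 - \<theta>) / 2)"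
      by (simp add: cos_diff_cos) (simp add: field_simps)
    moreover have "sin ((\<theta> + \<theta>0) / 2 - \<phi>) \<noteq> 0"
      using d(2) \<theta>(2) by (auto simp: dist_real_def subset_iff abs_minus_commute)
    moreover have "sin ((\<theta>0 - \<theta>) / 2) \<noteq> 0"
    proof (cases "\<theta> < \<theta>0")
      case True
      then have "0 < sin ((\<theta>0 - \<theta>) / 2)" using \<theta>(2) by (intro sin_gt_zero) auto
      then show ?thesis by simp
    next
      case False
      then have "0 < sin ((\<theta> - \<theta>0) / 2)" using \<theta> by (intro sin_gt_zero) auto
      moreover have "sin ((\<theta>0 - \<theta>) / 2) = - sin ((\<theta> - \<theta>0) / 2)"
        unfolding sin_minus[symmetric] by (rule arg_cong[of _ _ sin]) (simp add: field_simps)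
      ultimately show ?thesis by simp
    qed
    ultimately show "cos (\<theta> - \<phi>) \<noteq> cos (\<theta>0 - \<phi>)" by auto
  qed
qed

section \<open>The level circle at the boundary of the cell\<close>

locale polytope_vertex_frame = polytope_vertex +
  fixes e1 e2 :: "real^3"
  assumes frame: "orthonormal_frame q e1 e2"
begin

abbreviation "lp \<equiv> level_point q e1 e2"
abbreviation "D \<equiv> norm q"

lemma inner_e:
  "e1 \<bullet> e1 = 1" "e2 \<bullet> e2 = 1" "e1 \<bullet> e2 = 0" "e2 \<bullet> e1 = 0"
  "e1 \<bullet> q = 0" "e2 \<bullet> q = 0" "q \<bullet> e1 = 0" "q \<bullet> e2 = 0"
  using orthonormal_frame_inner[OF frame] by (simp_all add: inner_commute)

lemma D_pos: "D > 0" using q_nonzero by simp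

lemma q_lp: "q \<bullet> lp t \<theta> = t"
  using D_pos by (simp add: level_point_def inner_add inner_e dot_square_norm)

lemma norm_lp:
  assumes "\<bar>t\<bar> < D"
  shows "norm (lp t \<theta>) = 1"
proof -
  have "t\<^sup>2 < D\<^sup>2" using power_strict_mono[OF assms, of 2] by simp
  then have s: "(sqrt (1 - t\<^sup>2 / D\<^sup>2))\<^sup>2 = 1 - t\<^sup>2 / D\<^sup>2" using D_pos by simp
  define s where "s = sqrt (1 - t\<^sup>2 / D\<^sup>2)"
  have "lp t \<theta> \<bullet> lp t \<theta> = (t / D\<^sup>2)\<^sup>2 * (q \<bullet> q) + s\<^sup>2 * ((cos \<theta>)\<^sup>2 + (sin \<theta>)\<^sup>2)"
    unfolding level_point_def s_def[symmetric]
    by (simp add: inner_add inner_e power2_eq_square algebra_simps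
      del: sin_cos_squared_add sin_cos_squared_add2 sin_cos_squared_add3)
  also have "(t / D\<^sup>2)\<^sup>2 * (q \<bullet> q) = t\<^sup>2 / D\<^sup>2"
    using D_pos by (simp add: dot_square_norm power2_eq_square)
  also have "t\<^sup>2 / D\<^sup>2 + s\<^sup>2 * ((cos \<theta>)\<^sup>2 + (sin \<theta>)\<^sup>2) = 1" using s by (simp add: s_def)
  finally show ?thesis by (simp add: norm_eq_1)
qed

lemma aperture_eq: "aperture Q q e1 e2 t = circle_aperture N\<^sub>o q e1 e2 t"
  unfolding aperture_def circle_aperture_def interior_of_normal_cell using norm_lp by auto

lemma frame_expansion: "x = ((q \<bullet> x) / D\<^sup>2) *\<^sub>R q + (e1 \<bullet> x) *\<^sub>R e1 + (e2 \<bullet> x) *\<^sub>R e2"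
proof -
  have "(q /\<^sub>R D) \<bullet> (q /\<^sub>R D) = 1" using D_pos by (simp add: dot_square_norm power2_eq_square)
  then interpret orthonormal_triple e1 e2 "q /\<^sub>R D"
    by unfold_locales (simp_all add: inner_e)
  have "x = (x \<bullet> e1) *\<^sub>R e1 + (x \<bullet> e2) *\<^sub>R e2 + (x \<bullet> (q /\<^sub>R D)) *\<^sub>R (q /\<^sub>R D)" by (rule expansion)
  also have "(x \<bullet> (q /\<^sub>R D)) *\<^sub>R (q /\<^sub>R D) = ((q \<bullet> x) / D\<^sup>2) *\<^sub>R q"
    by (simp add: inner_commute[of x] power2_eq_square divide_inverse mult_ac)
  finally show ?thesis unfolding inner_commute[of x] by (simp add: add_ac)
qed

text \<open>At a point of tangency the vectors \<open>u\<close>, \<open>q\<close> and \<open>b\<close> are coplanar, so that \<open>u\<close> is the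
  normalised projection of \<open>q\<close> onto the plane orthogonal to \<open>b\<close>.\<close>

lemma met_tangency_valueI:
  assumes u: "u \<in> N" "norm u = 1" "b \<bullet> u = 0" and b: "supports_arc Q q b"
    and coplanar: "u = x *\<^sub>R q + y *\<^sub>R b"
  shows "q \<bullet> u \<in> met_tangency_values Q q"
proof -
  define t where "t = q \<bullet> u"
  have t: "t > 0" using q_pos[OF u(1)] u(2) r by (simp add: t_def)
  have b0: "b \<noteq> 0" using b by (simp add: supports_arc_def)
  \<comment> \<open>Pairing the coplanarity relation with \<open>u\<close> kills the term in
    \<open>b\<close> and yields \<open>x * t = 1\<close>, so the relation can be solved for
    \<open>q\<close>.\<close>
  have "1 = u \<bullet> u" using u(2) by (simp add: dot_square_norm)
  also have "u \<bullet> u = u \<bullet> (x *\<^sub>R q + y *\<^sub>R b)" using coplanar by simp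
  also have "\<dots> = x * t" using u(3) by (simp add: inner_add t_def inner_commute[of u])
  finally have xt: "x * t = 1" by simp
  have "t *\<^sub>R u = (x * t) *\<^sub>R q + (t * y) *\<^sub>R b" by (subst coplanar) (simp add: algebra_simps)
  then have q_eq: "q = t *\<^sub>R u - (t * y) *\<^sub>R b" by (simp add: xt)
  have qb: "q \<bullet> b = - (t * y) * (b \<bullet> b)" by (subst q_eq) (use u(3) in \<open>simp add: inner_diff inner_commute[of u b]\<close>)
  have "(q \<bullet> (b /\<^sub>R norm b)) *\<^sub>R (b /\<^sub>R norm b) = (- (t * y)) *\<^sub>R b"
    using b0 by (simp add: qb dot_square_norm power2_eq_square)
  \<comment> \<open>The projection of \<open>q\<close> is \<open>t *\<^sub>R u\<close>; its norm is
    \<open>t\<close> itself because \<open>t\<close> is positive.\<close>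
  then have "q - (q \<bullet> (b /\<^sub>R norm b)) *\<^sub>R (b /\<^sub>R norm b) = t *\<^sub>R u" by (subst (1) q_eq) simp
  then have "t \<in> arc_tangency_values q b"
    using t u(2) by (simp add: arc_tangency_values_def Let_def)
  moreover have "level_circle q t \<inter> great_circle b = {u}"
  proof (intro equalityI subsetI)
    fix v assume v: "v \<in> level_circle q t \<inter> great_circle b"
    then have v: "norm v = 1" "q \<bullet> v = t" "b \<bullet> v = 0" by (auto simp: level_circle_def great_circle_def)
    \<comment> \<open>A common point \<open>v\<close> has \<open>u \<bullet> v = 1\<close>, the
      equality case of Cauchy-Schwarz for unit vectors, so it is \<open>u\<close>.\<close>
    have "t = t * (u \<bullet> v)" using v(2) by (subst (asm) q_eq) (simp add: inner_diff v(3))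
    then have "u \<bullet> v = 1" using t by simp
    have "(u - v) \<bullet> (u - v) = u \<bullet> u + v \<bullet> v - 2 * (u \<bullet> v)"
      by (simp add: inner_diff inner_commute[of v u])
    also have "\<dots> = 0" using u(2) v(1) \<open>u \<bullet> v = 1\<close> by (simp add: dot_square_norm)
    finally have "u - v = 0" by simp
    then show "v \<in> {u}" by simp
  qed (use u in \<open>auto simp: level_circle_def great_circle_def t_def\<close>)
  moreover have "u \<in> boundary_arc Q q b"
    using u by (auto simp: boundary_arc_def normal_cell_def great_circle_def)
  ultimately show ?thesis using b unfolding met_tangency_values_def t_def by blast
qed

text \<open>The hypothesis, through its witness \<open>u\<close>, says that \<open>b\<close> is not
  a multiple of \<open>q\<close>. Then \<open>\<rho>\<close> and \<open>\<phi>\<close> are the polar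
  coordinates of the projection of \<open>b\<close> onto the plane of \<open>e1\<close> and
  \<open>e2\<close>.\<close>

lemma inner_lp:
  assumes b: "b \<bullet> u \<noteq> q \<bullet> u * (b \<bullet> q) / D\<^sup>2"
  obtains \<rho> \<phi> where "\<rho> > 0" "b = ((b \<bullet> q) / D\<^sup>2) *\<^sub>R q + \<rho> *\<^sub>R (cos \<phi> *\<^sub>R e1 + sin \<phi> *\<^sub>R e2)"
    "\<And>t \<theta>. b \<bullet> lp t \<theta> = t * (b \<bullet> q) / D\<^sup>2 + sqrt (1 - t\<^sup>2 / D\<^sup>2) * \<rho> * cos (\<theta> - \<phi>)"
proof -
  define \<rho> where "\<rho> = sqrt ((e1 \<bullet> b)\<^sup>2 + (e2 \<bullet> b)\<^sup>2)"
  have "(e1 \<bullet> b)\<^sup>2 + (e2 \<bullet> b)\<^sup>2 \<noteq> 0"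
  proof
    assume "(e1 \<bullet> b)\<^sup>2 + (e2 \<bullet> b)\<^sup>2 = 0"
    then have "e1 \<bullet> b = 0" "e2 \<bullet> b = 0" by (simp_all add: sum_power2_eq_zero_iff)
    then have *: "b = ((q \<bullet> b) / D\<^sup>2) *\<^sub>R q" using frame_expansion[of b] by simp
    have "b \<bullet> u = (q \<bullet> b) / D\<^sup>2 * (q \<bullet> u)" by (subst *) simp
    then show False using b by (simp add: inner_commute[of q b] mult.commute)
  qed
  then have \<rho>: "\<rho> > 0" "\<rho>\<^sup>2 = (e1 \<bullet> b)\<^sup>2 + (e2 \<bullet> b)\<^sup>2"
    unfolding \<rho>_def by (simp_all add: sum_power2_gt_zero_iff sum_power2_eq_zero_iff)
  then have "((e1 \<bullet> b) / \<rho>)\<^sup>2 + ((e2 \<bullet> b) / \<rho>)\<^sup>2 = 1"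
    by (metis add_divide_distrib divide_self_if less_irrefl power_divide power_not_zero)
  then obtain \<phi> where "(e1 \<bullet> b) / \<rho> = cos \<phi>" "(e2 \<bullet> b) / \<rho> = sin \<phi>" by (metis sincos_total_2pi)
  then have \<phi>: "e1 \<bullet> b = \<rho> * cos \<phi>" "e2 \<bullet> b = \<rho> * sin \<phi>" using \<rho>(1) by (auto simp: field_simps)
  show ?thesis
  proof (rule that[of \<rho> \<phi>])
    show "b = ((b \<bullet> q) / D\<^sup>2) *\<^sub>R q + \<rho> *\<^sub>R (cos \<phi> *\<^sub>R e1 + sin \<phi> *\<^sub>R e2)"
      by (subst frame_expansion) (simp add: \<phi> algebra_simps inner_commute[of q b])
    show "b \<bullet> lp t \<theta> = t * (b \<bullet> q) / D\<^sup>2 + sqrt (1 - t\<^sup>2 / D\<^sup>2) * \<rho> * cos (\<theta> - \<phi>)" for t \<theta>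
      using \<phi> by (simp add: level_point_def inner_add inner_commute[of b e1] inner_commute[of b e2] cos_diff algebra_simps)
  qed (rule \<rho>(1))
qed

lemma locally_constant_inner:
  assumes "open T" "open V" "t0 \<in> T" "\<theta>0 \<in> V"
    and iff: "\<And>t \<theta>. t \<in> T \<Longrightarrow> \<theta> \<in> V \<Longrightarrow> \<theta> \<in> S t \<longleftrightarrow> b \<bullet> lp t \<theta> > 0"
    and ne: "b \<bullet> lp t0 \<theta>0 \<noteq> 0"
  shows "locally_constant_membership S t0 \<theta>0"
proof -
  define G where "G = (if b \<bullet> lp t0 \<theta>0 > 0 then {y. b \<bullet> y > 0} else {y. b \<bullet> y < 0})"
  have "open G" "lp t0 \<theta>0 \<in> G" using ne by (auto simp: G_def open_halfspace_gt open_halfspace_lt)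
  then obtain T' V' where T': "open T'" "open V'" "t0 \<in> T'" "\<theta>0 \<in> V'"
    "\<And>t \<theta>. t \<in> T' \<Longrightarrow> \<theta> \<in> V' \<Longrightarrow> lp t \<theta> \<in> G" using level_point_preimage[OF q_nonzero, of G] by metis
  show ?thesis unfolding locally_constant_membership_def
  proof (intro exI conjI ballI)
    show "open (T \<inter> T')" "open (V \<inter> V')" "t0 \<in> T \<inter> T'" "\<theta>0 \<in> V \<inter> V'" using T' assms by auto
    fix t \<theta> assume "t \<in> T \<inter> T'" "\<theta> \<in> V \<inter> V'"
    then show "(\<theta> \<in> S t) = (b \<bullet> lp t0 \<theta>0 > 0)"
      using iff[of t \<theta>] T'(5)[of t \<theta>] by (auto simp: G_def split: if_splits)
  qed
qed

text \<open>Near a transversal intersection of the level circle with the boundary of the cell, the cell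
  cuts out an arc of the circle whose end point is given by an arc cosine.\<close>

lemma transversal_arc:
  assumes t0: "0 < t0" "t0 < D" and u: "u = lp t0 \<theta>0" "b \<bullet> u = 0" and b: "b \<noteq> 0"
    and TV: "open T" "open V" "t0 \<in> T" "\<theta>0 \<in> V"
    and iff: "\<And>t \<theta>. t \<in> T \<Longrightarrow> \<theta> \<in> V \<Longrightarrow> \<theta> \<in> S t \<longleftrightarrow> b \<bullet> lp t \<theta> > 0"
    and not_coplanar: "\<And>x y. u \<noteq> x *\<^sub>R q + y *\<^sub>R b"
  shows "\<exists>\<epsilon>0>0. (\<forall>\<theta>. \<theta> \<noteq> \<theta>0 \<longrightarrow> \<bar>\<theta> - \<theta>0\<bar> < \<epsilon>0 \<longrightarrow> locally_constant_membership S t0 \<theta>) \<and>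
        (\<forall>\<epsilon>. 0 < \<epsilon> \<longrightarrow> \<epsilon> < \<epsilon>0 \<longrightarrow> real_analytic_at (\<lambda>t. measure lebesgue ({\<theta>0-\<epsilon>..\<theta>0+\<epsilon>} \<inter> S t)) t0)"
proof -
  have qu: "q \<bullet> u = t0" by (simp add: u q_lp)
  \<comment> \<open>A witness that \<open>b\<close> is not parallel to \<open>q\<close>:
    \<open>b\<close> itself if it is orthogonal to \<open>q\<close>, and otherwise \<open>u\<close>,
    where positive height makes the right-hand side nonzero.\<close>
  obtain w where w: "b \<bullet> w \<noteq> q \<bullet> w * (b \<bullet> q) / D\<^sup>2"
  proof (cases "b \<bullet> q = 0")
    case True
    then show ?thesis using that[of b] b by simp
  next
    case False
    then show ?thesis using that[of u] u(2) qu t0 D_pos by simp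
  qed
  then obtain \<rho> \<phi> where \<rho>: "\<rho> > 0" and b_eq: "b = ((b \<bullet> q) / D\<^sup>2) *\<^sub>R q + \<rho> *\<^sub>R (cos \<phi> *\<^sub>R e1 + sin \<phi> *\<^sub>R e2)"
    and b_lp: "\<And>t \<theta>. b \<bullet> lp t \<theta> = t * (b \<bullet> q) / D\<^sup>2 + sqrt (1 - t\<^sup>2 / D\<^sup>2) * \<rho> * cos (\<theta> - \<phi>)"
    using inner_lp[OF w] by metis
  \<comment> \<open>Chosen so that \<open>b \<bullet> lp t \<theta>\<close> is a positive factor
    times \<open>cos (\<theta> - \<phi>) - g t\<close>.\<close>
  define k where "k = - (b \<bullet> q) / (D * \<rho>)"
  define g where "g t = k * t / sqrt (D\<^sup>2 - t\<^sup>2)" for t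
  have sD: "0 < D\<^sup>2 - t\<^sup>2" if "\<bar>t\<bar> < D" for t
    using power_strict_mono[OF that, of 2] by simp
  have b_lp': "b \<bullet> lp t \<theta> = sqrt (D\<^sup>2 - t\<^sup>2) / D * \<rho> * (cos (\<theta> - \<phi>) - g t)" if "\<bar>t\<bar> < D" for t \<theta>
  proof -
    have "1 - t\<^sup>2 / D\<^sup>2 = (D\<^sup>2 - t\<^sup>2) / D\<^sup>2" using D_pos by (simp add: field_simps)
    then have "sqrt (1 - t\<^sup>2 / D\<^sup>2) = sqrt (D\<^sup>2 - t\<^sup>2) / D" using D_pos by (simp add: real_sqrt_divide)
    moreover have "sqrt (D\<^sup>2 - t\<^sup>2) > 0" using sD[OF that] by simp
    ultimately show ?thesis unfolding b_lp g_def k_def using \<rho> D_pos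
      by (simp add: field_simps power2_eq_square)
  qed
  have pos: "sqrt (D\<^sup>2 - t\<^sup>2) / D * \<rho> > 0" if "\<bar>t\<bar> < D" for t
    using sD[OF that] \<rho> D_pos by simp
  have lt: "b \<bullet> lp t \<theta> > 0 \<longleftrightarrow> g t < cos (\<theta> - \<phi>)" and eq0: "b \<bullet> lp t \<theta> = 0 \<longleftrightarrow> cos (\<theta> - \<phi>) = g t"
    if "\<bar>t\<bar> < D" for t \<theta>
    unfolding b_lp'[OF that] zero_less_mult_iff[of "_ * \<rho>"] mult_eq_0_iff[of "_ * \<rho>"] using pos[OF that] by linarith+
  have t0D: "\<bar>t0\<bar> < D" using t0 by simp
  have c0: "cos (\<theta>0 - \<phi>) = g t0" using u eq0[OF t0D] by blast
  \<comment> \<open>A vanishing sine would make the horizontal part of \<open>u\<close> parallel to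
    that of \<open>b\<close>, so \<open>u\<close> would lie in the span of \<open>q\<close> and
    \<open>b\<close>.\<close>
  have sin0: "sin (\<theta>0 - \<phi>) \<noteq> 0"
  proof
    assume s0: "sin (\<theta>0 - \<phi>) = 0"
    define c where "c = cos (\<theta>0 - \<phi>)"
    have "cos \<theta>0 = cos ((\<theta>0 - \<phi>) + \<phi>)" "sin \<theta>0 = sin ((\<theta>0 - \<phi>) + \<phi>)" by simp_all
    then have cs: "cos \<theta>0 = c * cos \<phi>" "sin \<theta>0 = c * sin \<phi>"
      by (simp_all only: cos_add sin_add s0 c_def mult_zero_left diff_0_right add_0_left)
    define n where "n = cos \<phi> *\<^sub>R e1 + sin \<phi> *\<^sub>R e2"
    have "\<rho> *\<^sub>R n = b - ((b \<bullet> q) / D\<^sup>2) *\<^sub>R q" using b_eq unfolding n_def by (metis add_diff_cancel_left')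
    then have n: "n = (1/\<rho>) *\<^sub>R (b - ((b \<bullet> q) / D\<^sup>2) *\<^sub>R q)"
      using \<rho> by (metis divide_self_if less_irrefl mult.commute scaleR_one scaleR_scaleR times_divide_eq_right mult.right_neutral)
    have "u = (t0 / D\<^sup>2) *\<^sub>R q + (sqrt (1 - t0\<^sup>2 / D\<^sup>2) * c) *\<^sub>R n"
      by (simp add: u level_point_def cs n_def algebra_simps)
    also have "\<dots> = (t0 / D\<^sup>2 - sqrt (1 - t0\<^sup>2 / D\<^sup>2) * c / \<rho> * ((b \<bullet> q) / D\<^sup>2)) *\<^sub>R q
        + (sqrt (1 - t0\<^sup>2 / D\<^sup>2) * c / \<rho>) *\<^sub>R b"
      unfolding n by (simp add: scaleR_diff_right scaleR_diff_left)
    finally show False using not_coplanar by blast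
  qed
  obtain \<epsilon>1 where \<epsilon>1: "\<epsilon>1 > 0"
    "\<And>\<epsilon>. 0 < \<epsilon> \<Longrightarrow> \<epsilon> < \<epsilon>1 \<Longrightarrow> \<exists>K. \<forall>\<^sub>F c in nhds (cos (\<theta>0 - \<phi>)).
        measure lebesgue {\<theta>\<in>{\<theta>0-\<epsilon>..\<theta>0+\<epsilon>}. c < cos (\<theta> - \<phi>)} = K + arccos c"
    using arc_measure_arccos[OF sin0] by blast
  obtain \<epsilon>2 where \<epsilon>2: "\<epsilon>2 > 0" "\<And>\<theta>. \<theta> \<noteq> \<theta>0 \<Longrightarrow> \<bar>\<theta> - \<theta>0\<bar> < \<epsilon>2 \<Longrightarrow> cos (\<theta> - \<phi>) \<noteq> cos (\<theta>0 - \<phi>)"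
    using cos_ne_near[OF sin0] by blast
  obtain \<epsilon>3 where \<epsilon>3: "\<epsilon>3 > 0" "ball \<theta>0 \<epsilon>3 \<subseteq> V" using TV by (meson open_contains_ball)
  define \<epsilon>0 where "\<epsilon>0 = min \<epsilon>1 (min \<epsilon>2 \<epsilon>3)"
  have "\<epsilon>0 > 0" using \<epsilon>1 \<epsilon>2 \<epsilon>3 by (simp add: \<epsilon>0_def)
  moreover have "locally_constant_membership S t0 \<theta>" if "\<theta> \<noteq> \<theta>0" "\<bar>\<theta> - \<theta>0\<bar> < \<epsilon>0" for \<theta>
  proof (rule locally_constant_inner[OF TV(1,2,3) _ iff])
    show "\<theta> \<in> V" using that \<epsilon>3(2) by (auto simp: \<epsilon>0_def dist_real_def subset_iff abs_minus_commute)
    have "cos (\<theta> - \<phi>) \<noteq> cos (\<theta>0 - \<phi>)" by (rule \<epsilon>2(2)) (use that in \<open>auto simp: \<epsilon>0_def\<close>)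
    then show "b \<bullet> lp t0 \<theta> \<noteq> 0" using eq0[OF t0D] c0 by simp
  qed auto
  moreover have "real_analytic_at (\<lambda>t. measure lebesgue ({\<theta>0-\<epsilon>..\<theta>0+\<epsilon>} \<inter> S t)) t0"
    if \<epsilon>: "0 < \<epsilon>" "\<epsilon> < \<epsilon>0" for \<epsilon>
  proof -
    obtain K where K: "\<forall>\<^sub>F c in nhds (cos (\<theta>0 - \<phi>)).
        measure lebesgue {\<theta>\<in>{\<theta>0-\<epsilon>..\<theta>0+\<epsilon>}. c < cos (\<theta> - \<phi>)} = K + arccos c"
      using \<epsilon>1(2)[of \<epsilon>] \<epsilon> by (auto simp: \<epsilon>0_def)
    have "isCont g t0" unfolding g_def[abs_def] using sD[OF t0D] by (intro continuous_intros) auto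
    then have "filterlim g (nhds (cos (\<theta>0 - \<phi>))) (nhds t0)"
      unfolding c0 isCont_def tendsto_at_iff_tendsto_nhds .
    from eventually_compose_filterlim[OF K this]
    have ev1: "\<forall>\<^sub>F t in nhds t0. measure lebesgue {\<theta>\<in>{\<theta>0-\<epsilon>..\<theta>0+\<epsilon>}. g t < cos (\<theta> - \<phi>)} = K + arccos (g t)" .
    have ev2: "\<forall>\<^sub>F t in nhds t0. t \<in> T \<inter> {-D<..<D}"
      using TV t0 by (intro eventually_nhds_in_open) auto
    have "\<bar>g t0\<bar> < 1"
    proof (rule ccontr)
      assume "\<not> ?thesis"
      then have "(cos (\<theta>0 - \<phi>))\<^sup>2 \<ge> 1" unfolding c0 by (simp flip: abs_square_less_1 add: not_less)
      then show False using sin0 sin_cos_squared_add[of "\<theta>0 - \<phi>"] by (smt (verit) zero_less_power2)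
    qed
    then have "real_analytic_at (\<lambda>t. K + 1 * arccos (k * t / sqrt (D\<^sup>2 - t\<^sup>2))) t0"
      using t0D by (intro real_analytic_at_add real_analytic_at_const real_analytic_at_arccos) (simp_all add: g_def)
    then show ?thesis
    proof (rule real_analytic_at_cong)
      show "\<forall>\<^sub>F t in nhds t0. K + 1 * arccos (k * t / sqrt (D\<^sup>2 - t\<^sup>2)) = measure lebesgue ({\<theta>0-\<epsilon>..\<theta>0+\<epsilon>} \<inter> S t)"
        using ev1 ev2
      proof eventually_elim
        case (elim t)
        have "{\<theta>0-\<epsilon>..\<theta>0+\<epsilon>} \<subseteq> V"
          using \<epsilon> \<epsilon>3(2) by (intro subset_trans[OF _ \<epsilon>3(2)]) (auto simp: \<epsilon>0_def dist_real_def)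
        then have "{\<theta>0-\<epsilon>..\<theta>0+\<epsilon>} \<inter> S t = {\<theta>\<in>{\<theta>0-\<epsilon>..\<theta>0+\<epsilon>}. g t < cos (\<theta> - \<phi>)}"
          using iff[of t] lt[of t] elim(2) by fastforce
        then show ?case using elim(1) by (simp add: g_def)
      qed
    qed
  qed
  ultimately show ?thesis by blast
qed

lemma aperture_analytic:
  assumes "t0 \<notin> critical_values Q q"
  shows "real_analytic_at (aperture Q q e1 e2) t0"
proof -
  have axial: "t0 \<noteq> D" "t0 \<noteq> - D" and met: "t0 \<notin> met_tangency_values Q q" and vertex: "t0 \<notin> vertex_values Q q"
    using assms by (auto simp: critical_values_def axial_values_def)
  \<comment> \<open>The first case contains all heights that are not positive. The aperture vanishes
    identically around \<open>t0\<close> in the first two cases.\<close>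
  consider "t0 < r" | "D < \<bar>t0\<bar>" | "0 < t0" "t0 < D" using axial r by fastforce
  then show ?thesis
  proof cases
    case 1
    show ?thesis
    proof (rule real_analytic_at_zero_near[of "{..<r}"])
      fix t assume t: "t \<in> {..<r}"
      have "{\<theta>\<in>{0..<2*pi}. lp t \<theta> \<in> N\<^sub>o} = {}" if "\<bar>t\<bar> < D"
      proof -
        have "lp t \<theta> \<notin> N\<^sub>o" for \<theta>
          using q_pos[of "lp t \<theta>"] N\<^sub>o_subset norm_lp[OF that] t by (auto simp: q_lp)
        then show ?thesis by simp
      qed
      then show "aperture Q q e1 e2 t = 0" unfolding aperture_eq circle_aperture_def
        by (cases "\<bar>t\<bar> < D") (simp_all only: if_True if_False measure_empty)
    qed (use 1 in auto)
  next
    case 2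
    show ?thesis
    proof (rule real_analytic_at_zero_near[of "{t. D < \<bar>t\<bar>}"])
      show "open {t. D < \<bar>t\<bar>}" by (intro open_Collect_less continuous_intros)
    qed (use 2 in \<open>auto simp: aperture_def\<close>)
  next
    case 3
    define S where "S t = {\<theta>. lp t \<theta> \<in> N\<^sub>o}" for t
    have "real_analytic_at (\<lambda>t. measure lebesgue ({0..<2*pi} \<inter> S t)) t0"
    proof (rule real_analytic_at_periodic_measure)
      show "x + 2 * pi \<in> S t \<longleftrightarrow> x \<in> S t" for t x by (simp add: S_def level_point_def)
      show "S t \<in> sets lebesgue" for t
      proof -
        have "continuous_on UNIV (\<lambda>\<theta>. lp t \<theta>)" unfolding level_point_def by (intro continuous_intros)
        then have "open ((\<lambda>\<theta>. lp t \<theta>) -` N\<^sub>o)" by (rule open_vimage[OF open_N\<^sub>o])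
        then show ?thesis by (simp add: S_def vimage_def)
      qed
      fix \<theta>0
      define u where "u = lp t0 \<theta>0"
      have u: "norm u = 1" "q \<bullet> u = t0" using 3 by (simp_all add: u_def q_lp norm_lp)
      then have u0: "u \<noteq> 0" by auto
      let ?lc = "locally_constant_membership S t0"
      let ?crossing = "\<lambda>\<theta>0. \<exists>\<epsilon>0>0. (\<forall>\<theta>. \<theta> \<noteq> \<theta>0 \<longrightarrow> \<bar>\<theta> - \<theta>0\<bar> < \<epsilon>0 \<longrightarrow> ?lc \<theta>) \<and>
        (\<forall>\<epsilon>. 0 < \<epsilon> \<longrightarrow> \<epsilon> < \<epsilon>0 \<longrightarrow> real_analytic_at (\<lambda>t. measure lebesgue ({\<theta>0-\<epsilon>..\<theta>0+\<epsilon>} \<inter> S t)) t0)"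
      have lc: "?lc \<theta>0" if G: "open G" "u \<in> G" "\<And>y. y \<in> G \<Longrightarrow> (y \<in> N\<^sub>o) = v" for G v
      proof -
        obtain T V where "open T" "open V" "t0 \<in> T" "\<theta>0 \<in> V" "\<And>t \<theta>. t \<in> T \<Longrightarrow> \<theta> \<in> V \<Longrightarrow> lp t \<theta> \<in> G"
          using level_point_preimage[OF q_nonzero G(1) G(2)[unfolded u_def]] by metis
        then show ?thesis unfolding locally_constant_membership_def S_def using G(3)
          by (intro exI[of _ T] exI[of _ V] exI[of _ v]) simp
      qed
      show "?lc \<theta>0 \<or> ?crossing \<theta>0"
      proof (cases "u \<in> N")
        case False
        have "?lc \<theta>0" by (rule lc[of "- N" False]) (use closed_N False N\<^sub>o_subset in auto)
        then show ?thesis ..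
      next
        case uN: True
        show ?thesis
        proof (cases "\<exists>b\<in>W. b \<bullet> u = 0")
          case False
          then have "u \<in> N\<^sub>o" using uN by (fastforce simp: normal_cone_eq open_normal_cone_def less_le)
          then have "?lc \<theta>0" using open_N\<^sub>o by (intro lc[of N\<^sub>o True]) auto
          then show ?thesis ..
        next
          case True
          then obtain b where b: "b \<in> W" "b \<bullet> u = 0" by blast
          \<comment> \<open>Two independent active normals would make \<open>u\<close> a spherical
            vertex and its height a vertex value.\<close>
          have "\<not> (conic hull {u}) face_of N"
          proof
            assume "(conic hull {u}) face_of N"
            then have "q \<bullet> u \<in> vertex_values Q q" using u by (auto simp: vertex_values_def spherical_vertex_def)
            then show False using vertex u by simp
          qed
          then have par: "\<exists>c. b' = c *\<^sub>R b" if "b' \<in> W" "b' \<bullet> u = 0" for b'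
            using ray_face[OF uN u0 b(1) that(1) b(2) that(2)] by blast
          obtain \<epsilon> where \<epsilon>: "\<epsilon> > 0" "\<And>y. y \<in> ball u \<epsilon> \<Longrightarrow> y \<in> N\<^sub>o \<longleftrightarrow> b \<bullet> y > 0" and sa: "supports_arc Q q b"
            using facet_point[OF uN b par] by metis
          have "lp t0 \<theta>0 \<in> ball u \<epsilon>" using \<epsilon> by (simp add: u_def)
          then obtain T V where TV: "open T" "open V" "t0 \<in> T" "\<theta>0 \<in> V"
            "\<And>t \<theta>. t \<in> T \<Longrightarrow> \<theta> \<in> V \<Longrightarrow> lp t \<theta> \<in> ball u \<epsilon>"
            using level_point_preimage[OF q_nonzero open_ball] by metis
          have "?crossing \<theta>0"
          proof (rule transversal_arc[OF 3 u_def b(2) _ TV(1-4)])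
            show "b \<noteq> 0" using b zero_notin_W by auto
            show "\<theta> \<in> S t \<longleftrightarrow> b \<bullet> lp t \<theta> > 0" if "t \<in> T" "\<theta> \<in> V" for t \<theta>
              using \<epsilon>(2)[OF TV(5)[OF that]] by (simp add: S_def)
            \<comment> \<open>Coplanarity would be a tangency on the arc itself, so only the
              tangency candidates that meet their arc need be avoided.\<close>
            show "u \<noteq> x *\<^sub>R q + y *\<^sub>R b" for x y
              using met_tangency_valueI[OF uN u(1) b(2) sa] met u(2) by auto
          qed
          then show ?thesis ..
        qed
      qed
    qed simp
    then show ?thesis
    proof (rule real_analytic_at_cong)
      have "\<forall>\<^sub>F t in nhds t0. t \<in> {-D<..<D}" using 3 by (intro eventually_nhds_in_open) auto
      then show "\<forall>\<^sub>F t in nhds t0. measure lebesgue ({0..<2*pi} \<inter> S t) = aperture Q q e1 e2 t"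
        by eventually_elim (auto simp: aperture_eq circle_aperture_def S_def Int_def intro!: arg_cong[of _ _ "measure lebesgue"])
    qed
  qed
qed

end

subsection \<open>The law of the width\<close>

text \<open>The radial projection keeps a plane through the origin invariant both ways; the origin,
  sent to 0 by the convention for division, lies in the plane too.\<close>

lemma null_sets_uniform_sphere_hyperplane:
  fixes b :: "real^3"
  assumes "b \<noteq> 0"
  shows "{u. b \<bullet> u = 0} \<in> null_sets uniform_sphere"
proof -
  have meas: "(\<lambda>x::real^3. x /\<^sub>R norm x) \<in> borel_measurable borel" by measurable
  have H: "{u. b \<bullet> u = 0} \<in> sets borel" using closed_hyperplane by (rule borel_closed)
  let ?Y = "(\<lambda>x. x /\<^sub>R norm x) -` {u. b \<bullet> u = 0}"
  have Y: "?Y \<in> sets borel" using measurable_sets[OF meas H] by simp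
  have "negligible (ball 0 1 \<inter> ?Y)"
    by (rule negligible_subset[OF negligible_hyperplane[of b 0]]) (use assms in auto)
  then have "emeasure lborel (ball 0 1 \<inter> ?Y) = 0"
    using Y by (simp add: negligible_iff_null_sets null_sets_def)
  then have "emeasure (uniform_measure lborel (ball 0 1)) ?Y = 0"
    using Y by (subst emeasure_uniform_measure) auto
  then have "emeasure uniform_sphere {u. b \<bullet> u = 0} = 0"
    unfolding uniform_sphere_def using H meas by (subst emeasure_distr) auto
  then show ?thesis using H by (simp add: null_sets_def uniform_sphere_def)
qed

lemma exists_maximal_vertex:
  fixes Q :: "'a::euclidean_space set"
  assumes "polytope Q" "Q \<noteq> {}"
  shows "\<exists>q\<in>vert Q. u \<in> normal_cone Q q"
proof -
  have fin: "finite (vert Q)"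
    unfolding vert_def using finite_polyhedron_extreme_points assms(1) polytope_imp_polyhedron by blast
  have hull: "Q = convex hull (vert Q)"
    unfolding vert_def by (rule Krein_Milman_Minkowski) (use assms polytope_imp_compact polytope_imp_convex in auto)
  then have "vert Q \<noteq> {}" using assms(2) by force
  then obtain q where q: "q \<in> vert Q" "u \<bullet> q = Max ((\<lambda>x. u \<bullet> x) ` vert Q)"
    using fin Max_in[of "(\<lambda>x. u \<bullet> x) ` vert Q"] by fastforce
  then have "u \<bullet> x \<le> u \<bullet> q" if "x \<in> vert Q" for x using fin that by simp
  then have "convex hull (vert Q) \<subseteq> {x. u \<bullet> x \<le> u \<bullet> q}"
    by (intro hull_minimal convex_halfspace_le) auto
  then have "u \<in> normal_cone Q q" using hull by (auto simp: normal_cone_def)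
  then show ?thesis using q(1) by blast
qed

text \<open>Write the maximiser as \<open>x0 - y0\<close>. Varying one term at a time shows that
  \<open>x0\<close> is extremal for \<open>u\<close> and \<open>y0\<close> for
  \<open>- u\<close>.\<close>

lemma width_eq_inner:
  assumes "q \<in> {x - y | x y. x \<in> P \<and> y \<in> P}" "u \<in> normal_cone {x - y | x y. x \<in> P \<and> y \<in> P} q"
  shows "width P u = q \<bullet> u"
proof -
  obtain x0 y0 where xy: "q = x0 - y0" "x0 \<in> P" "y0 \<in> P" using assms(1) by blast
  have le: "u \<bullet> (x - y) \<le> u \<bullet> q" if "x \<in> P" "y \<in> P" for x y
    using assms(2) that unfolding normal_cone_def by blast
  have "support_function P u = u \<bullet> x0" unfolding support_function_def
    by (rule cSup_eq_maximum) (use le[OF _ xy(3)] xy in \<open>auto simp: inner_diff\<close>)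
  moreover have "support_function P (- u) = - u \<bullet> y0" unfolding support_function_def
    by (rule cSup_eq_maximum) (use le[OF xy(2)] xy in \<open>auto simp: inner_diff\<close>)
  ultimately show ?thesis by (simp add: width_def xy(1) inner_diff inner_commute)
qed

text \<open>Subtract the centre \<open>x\<close> from a ball around an interior point of
  \<open>P\<close>.\<close>

lemma cball_subset_differences:
  fixes P :: "'a::euclidean_space set"
  assumes "convex P" "aff_dim P = DIM('a)"
  obtains r where "r > 0" "cball 0 r \<subseteq> {x - y | x y. x \<in> P \<and> y \<in> P}"
proof -
  have "affine hull P = UNIV" using assms(2) aff_dim_eq_full by blast
  then have "interior P = rel_interior P" by (simp add: rel_interior_interior)
  moreover have "P \<noteq> {}" using assms(2) by auto
  ultimately have "interior P \<noteq> {}" using assms(1) rel_interior_eq_empty by metis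
  then obtain x where "x \<in> interior P" by blast
  then obtain r where r: "r > 0" "cball x r \<subseteq> P" using mem_interior_cball by blast
  have "cball 0 r \<subseteq> {x - y | x y. x \<in> P \<and> y \<in> P}"
  proof
    fix z :: 'a assume "z \<in> cball 0 r"
    then have "x + z \<in> P" "x \<in> P" using r by (auto simp: subset_iff dist_norm)
    moreover have "z = (x + z) - x" by simp
    ultimately show "z \<in> {x - y | x y. x \<in> P \<and> y \<in> P}" by blast
  qed
  with r(1) show ?thesis by (rule that)
qed

text \<open>Guarantees that on each interval of the partition the same vertices enter the sum for
  the density.\<close>

lemma interval_avoiding_ends:
  fixes I :: "real set"
  assumes "is_interval I" "d \<notin> I" "- d \<notin> I"
  shows "I \<subseteq> {t. \<bar>t\<bar> < d} \<or> I \<inter> {t. \<bar>t\<bar> < d} = {}"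
proof (rule ccontr)
  assume "\<not> ?thesis"
  then obtain s t where st: "s \<in> I" "\<not> \<bar>s\<bar> < d" "t \<in> I" "\<bar>t\<bar> < d" by auto
  have "s < - d \<or> d < s" using st assms by (metis abs_less_iff linorder_neqE_linordered_idom minus_less_iff)
  then show False
  proof
    assume "s < - d"
    then have "- d \<in> I" using mem_is_interval_1_I[OF assms(1) st(1,3), of "- d"] st(4) by auto
    then show False using assms by simp
  next
    assume "d < s"
    then have "d \<in> I" using mem_is_interval_1_I[OF assms(1) st(3,1), of d] st(4) by auto
    then show False using assms by simp
  qed
qed

lemma width_distribution:
  fixes P Q :: "(real^3) set"
  assumes P: "polytope P" "aff_dim P = 3" and Q: "Q = {x - y | x y. x \<in> P \<and> y \<in> P}"
    and frames: "\<And>q. q \<in> vert Q \<Longrightarrow> orthonormal_frame q (e1 q) (e2 q)"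
  shows "width P \<in> borel_measurable borel"
    and "\<And>q. q \<in> vert Q \<Longrightarrow> aperture Q q (e1 q) (e2 q) \<in> borel_measurable borel"
    and "\<And>A. A \<in> sets borel \<Longrightarrow> emeasure uniform_sphere {u. width P u \<in> A}
      = (\<integral>\<^sup>+t. ennreal (1 / (4 * pi) * (\<Sum>q | q \<in> vert Q \<and> \<bar>t\<bar> < norm q.
          aperture Q q (e1 q) (e2 q) t / norm q)) * indicator A t \<partial>lborel)"
proof -
  have polyQ: "polytope Q" unfolding Q by (rule polytope_differences[OF P(1)])
  obtain r where r: "r > 0" "cball 0 r \<subseteq> Q"
    using cball_subset_differences[OF polytope_imp_convex[OF P(1)]] P(2) unfolding Q by auto
  then have "Q \<noteq> {}" by force
  have vertex: "polytope_vertex_frame Q q r (e1 q) (e2 q)" if "q \<in> vert Q" for q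
    using polyQ r that frames by unfold_locales
  have vertex': "polytope_vertex Q q r" if "q \<in> vert Q" for q
    using vertex[OF that] polytope_vertex_frame.axioms(1) by blast
  have finV: "finite (vert Q)"
    unfolding vert_def using finite_polyhedron_extreme_points polyQ polytope_imp_polyhedron by blast
  have vQ: "vert Q \<subseteq> Q" by (auto simp: vert_def extreme_point_of_def)
  have width: "width P u = q \<bullet> u" if "q \<in> vert Q" "u \<in> normal_cone Q q" for u q
    using width_eq_inner[of q P u] that vQ unfolding Q by blast
  have maxv: "\<exists>q\<in>vert Q. u \<in> normal_cone Q q" for u
    by (rule exists_maximal_vertex[OF polyQ \<open>Q \<noteq> {}\<close>])
  \<comment> \<open>A maximum of finitely many linear functions, which gives Borel
    measurability.\<close>
  have "width P u = Max ((\<lambda>q. q \<bullet> u) ` vert Q)" for u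
  proof -
    obtain q where q: "q \<in> vert Q" "u \<in> normal_cone Q q" using maxv by blast
    have "Max ((\<lambda>q. q \<bullet> u) ` vert Q) = q \<bullet> u"
      by (rule Max_eqI) (use q finV vQ in \<open>auto simp: normal_cone_def inner_commute\<close>)
    then show ?thesis using width[OF q] by simp
  qed
  then have weq: "width P = (\<lambda>u. Max ((\<lambda>q. q \<bullet> u) ` vert Q))" by blast
  show meas: "width P \<in> borel_measurable borel" unfolding weq using finV by measurable
  have borelN: "open_normal_cone Q q \<in> sets borel" if "q \<in> vert Q" for q
    using polytope_vertex.open_N\<^sub>o[OF vertex'[OF that]] by simp
  have q0: "q \<noteq> 0" if "q \<in> vert Q" for q using polytope_vertex.q_nonzero[OF vertex'[OF that]] .
  have ap: "aperture Q q (e1 q) (e2 q) = circle_aperture (open_normal_cone Q q) q (e1 q) (e2 q)" if "q \<in> vert Q" for q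
    using polytope_vertex_frame.aperture_eq[OF vertex[OF that]] by blast
  show apm: "aperture Q q (e1 q) (e2 q) \<in> borel_measurable borel" if "q \<in> vert Q" for q
    unfolding ap[OF that] by (rule circle_aperture_measurable[OF frames[OF that] q0[OF that] borelN[OF that]])
  fix A :: "real set" assume A: "A \<in> sets borel"
  define F where "F q = {u \<in> open_normal_cone Q q. q \<bullet> u \<in> A}" for q
  have Fm: "F q \<in> sets uniform_sphere" if "q \<in> vert Q" for q
  proof -
    have "(\<lambda>u. q \<bullet> u) \<in> borel_measurable borel" by measurable
    from measurable_sets[OF this A] borelN[OF that] show ?thesis
      by (auto simp: F_def Collect_conj_eq vimage_def uniform_sphere_def)
  qed
  \<comment> \<open>Two vertices cannot both win strictly: the two strict inequalities have opposite
    left-hand sides.\<close>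
  have disj: "disjoint_family_on F (vert Q)"
  proof (unfold disjoint_family_on_def, intro ballI impI)
    fix q q' assume q: "q \<in> vert Q" "q' \<in> vert Q" "q \<noteq> q'"
    have "\<not> (u \<in> open_normal_cone Q q \<and> u \<in> open_normal_cone Q q')" for u
    proof
      assume "u \<in> open_normal_cone Q q \<and> u \<in> open_normal_cone Q q'"
      then have "(q - q') \<bullet> u > 0" "(q' - q) \<bullet> u > 0"
        using q by (auto simp: open_normal_cone_def vertex_differences_def)
      then show False by (simp add: inner_diff)
    qed
    then show "F q \<inter> F q' = {}" by (auto simp: F_def)
  qed
  \<comment> \<open>The directions in which two distinct vertices tie; finitely many planes contain
    them, and outside these planes the maximal vertex is unique.\<close>
  define H where "H = (\<Union>b\<in>(\<Union>q\<in>vert Q. vertex_differences Q q). {u. b \<bullet> u = 0})"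
  have Hnull: "H \<in> null_sets uniform_sphere" unfolding H_def
    using finV polytope_vertex.finite_W[OF vertex'] polytope_vertex.zero_notin_W[OF vertex']
    by (intro null_sets_UN' countable_finite finite_UN_I null_sets_uniform_sphere_hyperplane) auto
  have sub: "{u. width P u \<in> A} - (\<Union>q\<in>vert Q. F q) \<subseteq> H"
  proof
    fix u assume u: "u \<in> {u. width P u \<in> A} - (\<Union>q\<in>vert Q. F q)"
    obtain q where q: "q \<in> vert Q" "u \<in> normal_cone Q q" using maxv by blast
    then have "u \<notin> open_normal_cone Q q" using u width[OF q] by (auto simp: F_def)
    then obtain b where "b \<in> vertex_differences Q q" "\<not> b \<bullet> u > 0" by (auto simp: open_normal_cone_def)
    moreover from this have "b \<bullet> u \<ge> 0" using q(2) polytope_vertex.normal_cone_eq[OF vertex'[OF q(1)]] by auto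
    ultimately show "u \<in> H" using q(1) by (force simp: H_def)
  qed
  have sup: "(\<Union>q\<in>vert Q. F q) \<subseteq> {u. width P u \<in> A}"
  proof clarify
    fix q u assume q: "q \<in> vert Q" "u \<in> F q"
    then have "u \<in> normal_cone Q q" using polytope_vertex.N\<^sub>o_subset[OF vertex'[OF q(1)]] by (auto simp: F_def)
    then show "width P u \<in> A" using width[OF q(1)] q(2) by (simp add: F_def)
  qed
  have X: "{u. width P u \<in> A} \<in> sets uniform_sphere"
    using measurable_sets[OF meas A] by (simp add: uniform_sphere_def vimage_def)
  have UF: "(\<Union>q\<in>vert Q. F q) \<in> sets uniform_sphere" using finV Fm by auto
  have "emeasure uniform_sphere {u. width P u \<in> A} = emeasure uniform_sphere (\<Union>q\<in>vert Q. F q)"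
  proof (rule emeasure_eq_AE[OF _ X UF])
    show "AE u in uniform_sphere. u \<in> {u. width P u \<in> A} \<longleftrightarrow> u \<in> (\<Union>q\<in>vert Q. F q)"
      using AE_not_in[OF Hnull] by eventually_elim (use sub sup in blast)
  qed
  also have "\<dots> = (\<Sum>q\<in>vert Q. emeasure uniform_sphere (F q))"
    by (rule sum_emeasure[symmetric]) (use Fm disj finV in auto)
  also have "\<dots> = (\<Sum>q\<in>vert Q. \<integral>\<^sup>+t. ennreal (1 / (4 * pi) * (aperture Q q (e1 q) (e2 q) t / norm q)) * indicator A t \<partial>lborel)"
    unfolding F_def using emeasure_uniform_sphere_level[OF frames q0 borelN A] by (intro sum.cong) (simp_all add: ap)
  also have "\<dots> = (\<integral>\<^sup>+t. (\<Sum>q\<in>vert Q. ennreal (1 / (4 * pi) * (aperture Q q (e1 q) (e2 q) t / norm q)) * indicator A t) \<partial>lborel)"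
    using apm A by (intro nn_integral_sum[symmetric]) auto
  also have "\<dots> = (\<integral>\<^sup>+t. ennreal (1 / (4 * pi) * (\<Sum>q | q \<in> vert Q \<and> \<bar>t\<bar> < norm q.
          aperture Q q (e1 q) (e2 q) t / norm q)) * indicator A t \<partial>lborel)"
  proof (intro nn_integral_cong)
    fix t
    \<comment> \<open>Vertices with \<open>norm q \<le> \<bar>t\<bar>\<close> contribute 0 because
      the aperture is extended by zero, so the index set need not depend on
      \<open>t\<close>.\<close>
    have "(\<Sum>q | q \<in> vert Q \<and> \<bar>t\<bar> < norm q. aperture Q q (e1 q) (e2 q) t / norm q)
        = (\<Sum>q\<in>vert Q. aperture Q q (e1 q) (e2 q) t / norm q)"
      using finV by (intro sum.mono_neutral_left) (auto simp: aperture_def)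
    then have "ennreal (1 / (4 * pi) * (\<Sum>q | q \<in> vert Q \<and> \<bar>t\<bar> < norm q. aperture Q q (e1 q) (e2 q) t / norm q))
        = ennreal (\<Sum>q\<in>vert Q. 1 / (4 * pi) * (aperture Q q (e1 q) (e2 q) t / norm q))"
      by (simp only: sum_distrib_left)
    also have "\<dots> = (\<Sum>q\<in>vert Q. ennreal (1 / (4 * pi) * (aperture Q q (e1 q) (e2 q) t / norm q)))"
      by (rule sum_ennreal[symmetric]) (simp add: ap circle_aperture_nonneg)
    finally show "(\<Sum>q\<in>vert Q. ennreal (1 / (4 * pi) * (aperture Q q (e1 q) (e2 q) t / norm q)) * indicator A t)
       = ennreal (1 / (4 * pi) * (\<Sum>q | q \<in> vert Q \<and> \<bar>t\<bar> < norm q. aperture Q q (e1 q) (e2 q) t / norm q)) * indicator A t"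
      by (simp only: sum_distrib_right)
  qed
  finally show "emeasure uniform_sphere {u. width P u \<in> A} = \<dots>" .
qed

text \<open>\<open>U\<close> may live on any probability space, and the frames may depend on the
  vertex in any way, so no origin of angles is preferred. The complement of the union of all
  critical sets serves as one partition for all vertices simultaneously.\<close>

theorem theorem3p4:
  fixes P Q :: "(real^3) set" and M :: "'s measure" and U :: "'s \<Rightarrow> real^3"
    and e1 e2 :: "real^3 \<Rightarrow> real^3"
  assumes P: "polytope P" "aff_dim P = 3"
    and Q: "Q = {x - y | x y. x \<in> P \<and> y \<in> P}"
    and U: "prob_space M" "U \<in> borel_measurable M" "distr M borel U = uniform_sphere"
    and frames: "\<And>q. q \<in> vert Q \<Longrightarrow> orthonormal_frame q (e1 q) (e2 q)"
  shows
    "(\<forall>q\<in>vert Q. norm q > 0)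
     \<and> absolutely_continuous lborel (distr M borel (\<lambda>\<omega>. width P (U \<omega>)))
     \<and> distributed M lborel (\<lambda>\<omega>. width P (U \<omega>))
         (\<lambda>t. ennreal (1 / (4 * pi) *
            (\<Sum>q | q \<in> vert Q \<and> \<bar>t\<bar> < norm q. aperture Q q (e1 q) (e2 q) t / norm q)))
     \<and> (\<forall>q\<in>vert Q.
       finite (candidate_values Q q)
       \<and> branch_changes (aperture Q q (e1 q) (e2 q)) \<subseteq> candidate_values Q q
       \<and> finite (critical_values Q q)
       \<and> critical_values Q q \<subseteq> candidate_values Q q
       \<and> (\<forall>I\<in>components (- critical_values Q q).
            is_interval I \<and> real_analytic_on (aperture Q q (e1 q) (e2 q)) I))
     \<and> finite (vert Q)
     \<and> finite (\<Union>q\<in>vert Q. critical_values Q q)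
     \<and> finite {(q, I). q \<in> vert Q \<and> I \<in> components (- critical_values Q q)}
     \<and> finite (components (- (\<Union>q\<in>vert Q. critical_values Q q)))
     \<and> (\<forall>I\<in>components (- (\<Union>q\<in>vert Q. critical_values Q q)). \<forall>q\<in>vert Q.
          (I \<subseteq> {t. \<bar>t\<bar> < norm q} \<or> I \<inter> {t. \<bar>t\<bar> < norm q} = {})
          \<and> real_analytic_on (aperture Q q (e1 q) (e2 q)) I)"
proof -
  define f where "f t = ennreal (1 / (4 * pi) *
      (\<Sum>q | q \<in> vert Q \<and> \<bar>t\<bar> < norm q. aperture Q q (e1 q) (e2 q) t / norm q))" for t
  have polyQ: "polytope Q" unfolding Q by (rule polytope_differences[OF P(1)])
  obtain r where r: "r > 0" "cball 0 r \<subseteq> Q"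
    using cball_subset_differences[OF polytope_imp_convex[OF P(1)]] P(2) unfolding Q by auto
  have vertex: "polytope_vertex_frame Q q r (e1 q) (e2 q)" if "q \<in> vert Q" for q
    using polyQ r that frames by unfold_locales
  have vertex': "polytope_vertex Q q r" if "q \<in> vert Q" for q
    using vertex[OF that] polytope_vertex_frame.axioms(1) by blast
  have finV: "finite (vert Q)"
    unfolding vert_def using finite_polyhedron_extreme_points polyQ polytope_imp_polyhedron by blast
  note wd = width_distribution[OF P Q frames]
  have fm: "f \<in> borel_measurable borel"
  proof -
    have "f t = ennreal (1 / (4 * pi) * (\<Sum>q\<in>vert Q. aperture Q q (e1 q) (e2 q) t / norm q))" for t
      unfolding f_def using finV
      by (intro arg_cong[of _ _ ennreal] arg_cong2[of _ _ _ _ "(*)"] refl sum.mono_neutral_left) (auto simp: aperture_def)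
    then have "f = (\<lambda>t. ennreal (1 / (4 * pi) * (\<Sum>q\<in>vert Q. aperture Q q (e1 q) (e2 q) t / norm q)))" by blast
    moreover have "(\<lambda>t. 1 / (4 * pi) * (\<Sum>q\<in>vert Q. aperture Q q (e1 q) (e2 q) t / norm q)) \<in> borel_measurable borel"
      by (intro borel_measurable_times borel_measurable_const borel_measurable_sum borel_measurable_divide wd(2))
    ultimately show ?thesis by simp
  qed
  have W: "(\<lambda>\<omega>. width P (U \<omega>)) \<in> borel_measurable M" using U(2) wd(1) by (rule measurable_compose)
  have law: "distr M lborel (\<lambda>\<omega>. width P (U \<omega>)) = density lborel f"
  proof (rule measure_eqI)
    fix A assume "A \<in> sets (distr M lborel (\<lambda>\<omega>. width P (U \<omega>)))"
    then have A: "A \<in> sets borel" by simp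
    have X: "{u. width P u \<in> A} \<in> sets borel" using measurable_sets[OF wd(1) A] by (simp add: vimage_def)
    have "emeasure (distr M lborel (\<lambda>\<omega>. width P (U \<omega>))) A = emeasure M ((\<lambda>\<omega>. width P (U \<omega>)) -` A \<inter> space M)"
      using W A by (intro emeasure_distr) auto
    also have "\<dots> = emeasure (distr M borel U) {u. width P u \<in> A}"
      using U(2) X by (subst emeasure_distr) (auto simp: vimage_def)
    also have "\<dots> = emeasure (density lborel f) A"
      unfolding U(3) f_def using wd(3)[OF _ A] fm A by (subst emeasure_density) (simp_all add: f_def[abs_def])
    finally show "emeasure (distr M lborel (\<lambda>\<omega>. width P (U \<omega>))) A = emeasure (density lborel f) A" .
  qed simp
  have dist: "distributed M lborel (\<lambda>\<omega>. width P (U \<omega>)) f"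
    unfolding distributed_def using law fm W by simp
  \<comment> \<open>\<open>distributed\<close> speaks of the image measure over
    \<open>lborel\<close>, the conclusion of the one over \<open>borel\<close>; the two have the
    same measurable sets.\<close>
  have "distr M borel (\<lambda>\<omega>. width P (U \<omega>)) = density lborel f"
    using law by (metis distr_cong sets_lborel)
  then have ac: "absolutely_continuous lborel (distr M borel (\<lambda>\<omega>. width P (U \<omega>)))"
    using fm by (simp add: absolutely_continuousI_density)
  have analytic: "real_analytic_at (aperture Q q (e1 q) (e2 q)) t"
    if "q \<in> vert Q" "t \<notin> critical_values Q q" for q t
    using polytope_vertex_frame.aperture_analytic[OF vertex[OF that(1)] that(2)] .
  have fin_cand: "finite (candidate_values Q q)" and crit: "critical_values Q q \<subseteq> candidate_values Q q"
    if "q \<in> vert Q" for q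
    using polytope_vertex.finite_candidate_values[OF vertex'[OF that]]
      polytope_vertex.critical_subset_candidate[OF vertex'[OF that]] by auto
  then have fin_crit: "finite (critical_values Q q)" if "q \<in> vert Q" for q using that finite_subset by blast
  have interval: "is_interval I" if "I \<in> components S" for I S :: "real set"
    using in_components_connected[OF that] by (simp add: is_interval_connected_1)
  have on: "real_analytic_on (aperture Q q (e1 q) (e2 q)) I"
    if "q \<in> vert Q" "I \<subseteq> - critical_values Q q" for q I
    unfolding real_analytic_on_def using analytic that by blast
  have 1: "\<forall>q\<in>vert Q. norm q > 0" using polytope_vertex.q_nonzero[OF vertex'] by simp
  have 2: "\<forall>q\<in>vert Q. finite (candidate_values Q q)
       \<and> branch_changes (aperture Q q (e1 q) (e2 q)) \<subseteq> candidate_values Q q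
       \<and> finite (critical_values Q q) \<and> critical_values Q q \<subseteq> candidate_values Q q
       \<and> (\<forall>I\<in>components (- critical_values Q q).
            is_interval I \<and> real_analytic_on (aperture Q q (e1 q) (e2 q)) I)"
  proof (intro ballI conjI)
    fix q assume q: "q \<in> vert Q"
    show "branch_changes (aperture Q q (e1 q) (e2 q)) \<subseteq> candidate_values Q q"
      using analytic[OF q] crit[OF q] by (auto simp: branch_changes_def)
    fix I assume "I \<in> components (- critical_values Q q)"
    then show "is_interval I" "real_analytic_on (aperture Q q (e1 q) (e2 q)) I"
      using interval on[OF q] in_components_subset by blast+
  qed (use fin_cand fin_crit crit in auto)
  have 3: "finite (\<Union>q\<in>vert Q. critical_values Q q)" using finV fin_crit by blast
  have "{(q, I). q \<in> vert Q \<and> I \<in> components (- critical_values Q q)}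
      = Sigma (vert Q) (\<lambda>q. components (- critical_values Q q))" by auto
  then have 4: "finite {(q, I). q \<in> vert Q \<and> I \<in> components (- critical_values Q q)}"
    using finV fin_crit by (simp add: finite_components_compl)
  have 5: "finite (components (- (\<Union>q\<in>vert Q. critical_values Q q)))"
    by (rule finite_components_compl[OF 3])
  have 6: "\<forall>I\<in>components (- (\<Union>q\<in>vert Q. critical_values Q q)). \<forall>q\<in>vert Q.
          (I \<subseteq> {t. \<bar>t\<bar> < norm q} \<or> I \<inter> {t. \<bar>t\<bar> < norm q} = {})
          \<and> real_analytic_on (aperture Q q (e1 q) (e2 q)) I"
  proof (intro ballI)
    fix I q assume I: "I \<in> components (- (\<Union>q\<in>vert Q. critical_values Q q))" and q: "q \<in> vert Q"
    have sub: "I \<subseteq> - critical_values Q q" using in_components_subset[OF I] q by blast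
    \<comment> \<open>The axial values are never discarded, so an interval of the partition cannot
      cross the ends of the range of any vertex.\<close>
    then have "norm q \<notin> I" "- norm q \<notin> I" by (auto simp: critical_values_def axial_values_def)
    then show "(I \<subseteq> {t. \<bar>t\<bar> < norm q} \<or> I \<inter> {t. \<bar>t\<bar> < norm q} = {})
          \<and> real_analytic_on (aperture Q q (e1 q) (e2 q)) I"
      using interval_avoiding_ends[OF interval[OF I]] on[OF q sub] by blast
  qed
  from 1 ac dist[unfolded f_def[abs_def]] 2 finV 3 4 5 6 show ?thesis by (intro conjI)
qed

end
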